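(* Let $x\in\mathbb{C}\setminus(\mathbb{R}^-\cup\{1\})$ and let $\nu\in\mathbb{C}$ with $\mathrm{Re}(\nu)<0$. Let $\mathscr{H}_0$ and the operator $\mathfrak{L}:\mathscr{H}_0\to\mathscr{H}_0$ be as defined in the context. Then: (a) the operator $\mathfrak{L}:\mathscr{H}_0\to\mathscr{H}_0$ is a bijection; (b) for every $K\in\mathscr{H}_0$, the unique solution $E^*=\mathfrak{L}^{-1}K\in\mathscr{H}_0$ of the equation $\mathfrak{L}E^*=K$ has the integral representation $$E^*(z)=\mathfrak{L}^{-1}K(z)=\frac{1-x}{2i\pi x}\,e^{z}\int_1^{(0+)}\frac{e^{-xtz}}{t(t-1)}\,K\left(z\,(-t)^{\nu}(1-t)^{1-\nu}\right)\mathrm{d}t,\qquad z\in\mathbb{C},$$ where the contour in the variable $t$ is a bounded loop starting and ending at the point $t=1$ and encircling the origin $t=0$ once in the positive sense.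
   Context: $\mathbb{R}^-=(-\infty,0]$. $\mathscr{H}_0$ is the complex linear space of entire functions on $\mathbb{C}$ vanishing at $0$. For $x\in\mathbb{C}\setminus(\mathbb{R}^-\cup\{1\})$ and $\mathrm{Re}(\nu)<0$, set $$\mathfrak{R}(\zeta)=x(1-\zeta)^{-\nu}\left(1-(1-x)\zeta\right)^{\nu-1},\quad \zeta\in[0,1],\qquad c=\frac{1-\nu x}{1-x},$$ with principal powers, and define the operator $\mathfrak{L}:\mathscr{H}_0\to\mathscr{H}_0$ by $$\mathfrak{L}f(z)=\int_0^1\left[(1+z\,\mathfrak{R}(\zeta))\,f(\zeta\,\mathfrak{R}(\zeta)\,z)-c\,z\,\mathfrak{R}(\zeta)\,f'(\zeta\,\mathfrak{R}(\zeta)\,z)\right]e^{-\mathfrak{R}(\zeta)z}\,\mathrm{d}\zeta,\qquad z\in\mathbb{C},$$ where $f'$ is the derivative of $f$. Contour and branch conventions: $\int_1^{(0+)}$ denotes integration along a bounded (piecewise smooth) simple loop which starts at $t=1$ (entering the upper half-plane), goes once counterclockwise around $0$, and returns to $t=1$ (from the lower half-plane), lying in $\mathbb{C}\setminus[0,+\infty)$ except for its endpoint $t=1$. The powers $(-t)^\nu$ and $(1-t)^{1-\nu}$ are principal: $|\arg(-t)|<\pi$ and $|\arg(1-t)|<\pi$ on the contour. *)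

theory Defs
  imports "HOL-Complex_Analysis.Complex_Analysis"
begin

definition H0 :: "(complex \<Rightarrow> complex) set" where
  "H0 = {f. f holomorphic_on UNIV \<and> f 0 = 0}"

(* powr on complex numbers is the principal power, with 0 powr a = 0; under Re nu < 0 this is the
   continuous extension of (1 - zeta) powr (- nu) to zeta = 1. *)
definition Rker :: "complex \<Rightarrow> complex \<Rightarrow> real \<Rightarrow> complex" where
  "Rker x \<nu> \<zeta> =
     x * (1 - of_real \<zeta>) powr (- \<nu>) * (1 - (1 - x) * of_real \<zeta>) powr (\<nu> - 1)"

definition cpar :: "complex \<Rightarrow> complex \<Rightarrow> complex" where
  "cpar x \<nu> = (1 - \<nu> * x) / (1 - x)"

definition Lop ::
  "complex \<Rightarrow> complex \<Rightarrow> (complex \<Rightarrow> complex) \<Rightarrow> complex \<Rightarrow> complex" where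
  "Lop x \<nu> f z = integral {0..1} (\<lambda>\<zeta>.
     ((1 + z * Rker x \<nu> \<zeta>) * f (of_real \<zeta> * Rker x \<nu> \<zeta> * z)
       - cpar x \<nu> * z * Rker x \<nu> \<zeta> * deriv f (of_real \<zeta> * Rker x \<nu> \<zeta> * z))
     * exp (- Rker x \<nu> \<zeta> * z))"

(* The admissible contours for the integral from 1 around 0 back to 1. The path image contains
   no point of the cut other than the base point 1, so that away from the base point both
   (-t) powr nu and (1 - t) powr (1 - nu) are holomorphic along the contour. *)
definition loop_from_1_around_0 :: "(real \<Rightarrow> complex) \<Rightarrow> bool" where
  "loop_from_1_around_0 \<gamma> \<longleftrightarrow>
     valid_path \<gamma> \<and> simple_path \<gamma> \<and> pathstart \<gamma> = 1 \<and> pathfinish \<gamma> = 1 \<and>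
     path_image \<gamma> \<inter> \<real>\<^sub>\<ge>\<^sub>0 = {1} \<and>
     (\<forall>\<^sub>F s in at_right 0. Im (\<gamma> s) > 0) \<and>
     (\<forall>\<^sub>F s in at_left 1. Im (\<gamma> s) < 0) \<and>
     winding_number \<gamma> 0 = 1"

(* At the base point t = 1 the formula evaluates to 0 (division by zero), which is also the limit
   of the integrand along the contour when K is in H0 and Re nu < 0. *)
definition inv_integrand ::
  "complex \<Rightarrow> complex \<Rightarrow> (complex \<Rightarrow> complex) \<Rightarrow> complex \<Rightarrow> complex \<Rightarrow> complex" where
  "inv_integrand x \<nu> K z t =
     exp (- x * t * z) / (t * (t - 1)) * K (z * (- t) powr \<nu> * (1 - t) powr (1 - \<nu>))"

(* The class of admissible contours is not empty. *)
lemma loop_from_1_around_0_circlepath: "loop_from_1_around_0 (circlepath 0 1)"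
proof -
  have im: "Im (circlepath 0 1 s) = sin (2 * pi * s)" for s
    by (simp add: circlepath Im_exp)
  have up: "\<forall>\<^sub>F s in at_right 0. Im (circlepath 0 1 s) > 0"
    unfolding eventually_at_right_field
  proof (intro exI[of _ "1/2"] conjI allI impI)
    fix s :: real assume "0 < s" "s < 1/2"
    then show "Im (circlepath 0 1 s) > 0"
      unfolding im by (intro sin_gt_zero) auto
  qed simp
  have down: "\<forall>\<^sub>F s in at_left 1. Im (circlepath 0 1 s) < 0"
    unfolding eventually_at_left_field
  proof (intro exI[of _ "1/2"] conjI allI impI)
    fix s :: real assume "1/2 < s" "s < 1"
    then show "Im (circlepath 0 1 s) < 0"
      unfolding im by (intro sin_lt_zero) auto
  qed simp
  have "path_image (circlepath 0 1) \<inter> \<real>\<^sub>\<ge>\<^sub>0 = {1::complex}"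
    by (auto simp: complex_nonneg_Reals_iff complex_eq_iff cmod_def power2_eq_1_iff)
  then show ?thesis
    unfolding loop_from_1_around_0_def using up down
    by (simp add: simple_path_circlepath winding_number_circlepath_centre)
qed

end

theory Submission
  imports Defs
begin

text \<open>
  Write \<open>R\<close> for \<open>Rker x \<nu>\<close> and \<open>D = (1 - \<zeta>)(1 - (1 - x)\<zeta>)\<close>. The theorem rests on the observation that the
  two operators involve the same kernel. On the slit plane, with \<open>u = 1 / t\<close>, the branches satisfy
  \<open>(-t)^\<nu> (1 - t)^(1 - \<nu>) = - (1 - u)^(1 - \<nu>) / u\<close> (lemma \<open>powr_reciprocal\<close>), and the right-hand side is
  single-valued near \<open>u = 0\<close>. So the loop integral equals an integral over the unit circle in \<open>u\<close>, and
  this circle may be contracted to a small one. In the variable \<open>\<zeta> = u / (u - x)\<close> the integrand,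
  taken together with the prefactor \<open>exp z\<close>, becomes \<open>exp (z / \<zeta>) K (z / (\<zeta> R(\<zeta>))) / D\<close> up to a
  constant factor, which mirrors the shape of \<open>Lop x \<nu>\<close>.

  On Taylor coefficients both operators act by lower triangular matrices (\<open>Lop_power_series\<close>,
  \<open>M_op_power_series\<close>). The entries of the first are built from the integrals
  \<open>J_b(l) = \<integral> R^b \<zeta>^l d\<zeta>\<close> over \<open>[0,1]\<close>, those of the second from the residues \<open>n_k(l)\<close>
  of \<open>\<zeta>^(-l) R^(-k) / D\<close> at \<open>0\<close>, up to a factor independent of \<open>l\<close>. Since \<open>D R' / R\<close> is a
  linear polynomial, integration of suitable derivatives yields three-term recurrences in \<open>l\<close>
  for both families. These recurrences are nearly adjoint, and their Casorati determinant
  \<open>C_l = (1 - x)(l + 1 - b) n_k(l) J_b(l) - l n_k(l + 1) J_b(l - 1)\<close> satisfies a discrete Lagrange identity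
  (\<open>casorati_step\<close>). By it the entries of the matrix product below the diagonal are telescoping sums with
  value \<open>0\<close>; for \<open>k = b\<close> the determinant is constant in \<open>l\<close>, and its value gives the diagonal entries \<open>1\<close>.

  Hence \<open>Lop x \<nu>\<close> has the right inverse \<open>M_op\<close> and is surjective; its matrix has nonzero diagonal
  entries, so it is injective, and \<open>M_op\<close> is its inverse. Finally, all admissible loops give the same
  integral, because it is a difference of boundary values at \<open>1\<close> of a primitive on the slit plane.
\<close>

section \<open>Entire functions and their power series\<close>

lemma entire_power_series:
  assumes "f holomorphic_on UNIV"
  shows "(\<lambda>n. (deriv ^^ n) f 0 / fact n * z ^ n) sums f z"
  using holomorphic_power_series[of f 0 "norm z + 1" z] assms holomorphic_on_subset by fastforce

lemma H0_power_series:
  assumes "f \<in> H0"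
  obtains a where "\<And>z. (\<lambda>n. a n * z ^ n) sums f z" "a 0 = 0"
proof
  show "(\<lambda>n. (deriv ^^ n) f 0 / fact n * z ^ n) sums f z" for z
    using assms entire_power_series by (simp add: H0_def)
  show "(deriv ^^ 0) f 0 / fact 0 = 0"
    using assms by (simp add: H0_def)
qed

lemma power_series_in_H0:
  assumes f: "\<And>z. (\<lambda>n. a n * z ^ n) sums f z" and "a 0 = 0"
  shows "f \<in> H0"
proof -
  have "f holomorphic_on ball 0 r" for r
    by (rule power_series_holomorphic[where a = a]) (use f in simp)
  then have "f holomorphic_on (\<Union>r. ball 0 r)"
    by (simp add: holomorphic_on_UN_open)
  moreover have "(\<Union>r. ball 0 r) = (UNIV :: complex set)"
    using gt_ex by fastforce
  moreover have "f 0 = 0"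
    using f[of 0] powser_sums_zero[of a] assms(2) sums_unique2 by metis
  ultimately show ?thesis by (simp add: H0_def)
qed

lemma entire_coeffs_unique:
  fixes a b :: "nat \<Rightarrow> complex"
  assumes "\<And>z. (\<lambda>n. a n * z ^ n) sums f z" "\<And>z. (\<lambda>n. b n * z ^ n) sums f z"
  shows "a = b"
proof -
  have s: "(\<lambda>n. (a n - b n) * (z - 0) ^ n) sums 0" for z
    using sums_diff[OF assms(1)[of z] assms(2)[of z]] by (simp add: left_diff_distrib)
  have "a m = b m" for m
  proof (cases m)
    case 0
    then show ?thesis
      using assms[of 0] powser_sums_zero[of a] powser_sums_zero[of b] sums_unique2 by metis
  next
    case (Suc k)
    show ?thesis
    proof (rule ccontr)
      \<comment> \<open>The zeros of the difference series would be isolated, yet its sum vanishes identically.\<close>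
      assume "a m \<noteq> b m"
      then obtain e where e: "e > 0" "\<And>z. z \<in> cball (0::complex) e - {0} \<Longrightarrow> (0::complex) \<noteq> 0"
        using powser_0_nonzero[of 1 0 "\<lambda>n. a n - b n" "\<lambda>_. 0" m] s Suc by auto
      then have "of_real e \<in> cball (0::complex) e - {0}" by simp
      then show False using e(2) by blast
    qed
  qed
  then show ?thesis by blast
qed

lemma continuous_bound_unit_interval:
  fixes p :: "real \<Rightarrow> complex"
  assumes "continuous_on {0..1} p"
  obtains B where "B \<ge> 0" "\<And>s. s \<in> {0..1} \<Longrightarrow> norm (p s) \<le> B"
proof -
  have "bounded (p ` {0..1})"
    by (intro compact_imp_bounded compact_continuous_image assms compact_Icc)
  then obtain B where "\<forall>y\<in>p ` {0..1}. norm y \<le> B" by (auto simp: bounded_iff)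
  then show ?thesis
    by (intro that[of "max B 0"]) (auto simp: max.coboundedI1)
qed

text \<open>
  Both operators of the theorem average functions of the shape \<open>f (q z) exp (p z)\<close> over a compact
  parameter interval. Expanding the two factors and multiplying the series gives, for each parameter,
  a power series in \<open>z\<close> whose terms are dominated by those of the Cauchy product of two convergent
  series of constants; so the averages of the coefficients are the coefficients of the average.
\<close>

lemma integral_times_exp_power_series:
  fixes p q w :: "real \<Rightarrow> complex"
  assumes p: "continuous_on {0..1} p" and q: "continuous_on {0..1} q" and w: "continuous_on {0..1} w"
    and f: "\<And>z. (\<lambda>n. a n * z ^ n) sums f z"
  shows "(\<lambda>n. (\<Sum>k\<le>n. a k * integral {0..1} (\<lambda>s. w s * q s ^ k * p s ^ (n - k)) / fact (n - k)) * z ^ n)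
    sums integral {0..1} (\<lambda>s. w s * (f (q s * z) * exp (p s * z)))" (is "?c sums _")
proof -
  obtain P where P: "P \<ge> 0" "\<And>s. s \<in> {0..1} \<Longrightarrow> norm (p s) \<le> P"
    using continuous_bound_unit_interval[OF p] by metis
  obtain Q where Q: "Q \<ge> 0" "\<And>s. s \<in> {0..1} \<Longrightarrow> norm (q s) \<le> Q"
    using continuous_bound_unit_interval[OF q] by metis
  obtain W where W: "W \<ge> 0" "\<And>s. s \<in> {0..1} \<Longrightarrow> norm (w s) \<le> W"
    using continuous_bound_unit_interval[OF w] by metis
  define t where "t = (\<lambda>n s. w s * (\<Sum>k\<le>n. (a k * (q s * z) ^ k) * ((p s * z) ^ (n - k) / fact (n - k))))"
  \<comment> \<open>The majorant: the same Cauchy product with \<open>p\<close>, \<open>q\<close>, \<open>w\<close> replaced by their bounds.\<close>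
  define M where "M = (\<lambda>n. W * (\<Sum>k\<le>n. (norm (a k) * (Q * norm z) ^ k) * ((P * norm z) ^ (n - k) / fact (n - k))))"
  have norm_summable: "summable (\<lambda>n. norm (a n * y ^ n))" for y
  proof (rule powser_insidea)
    show "summable (\<lambda>n. a n * of_real (norm y + 1) ^ n)"
      using f sums_summable by blast
    show "norm y < norm (of_real (norm y + 1) :: complex)"
      by (simp only: norm_of_real)
  qed
  have exp_sums: "(\<lambda>n. y ^ n / fact n) sums exp y" for y :: complex
    using exp_converges[of y] by (simp add: scaleR_conv_of_real field_simps)
  have exp_summable: "summable (\<lambda>n. norm (y ^ n / fact n))" for y :: complex
    using summable_norm_exp[of y] by (simp add: norm_divide norm_power field_simps)
  have pointwise: "(\<lambda>n. t n s) sums (w s * (f (q s * z) * exp (p s * z)))" for s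
    unfolding t_def
    using Cauchy_product_sums[OF norm_summable[of "q s * z"] exp_summable[of "p s * z"]]
      sums_unique[OF f[of "q s * z"]] sums_unique[OF exp_sums[of "p s * z"]]
    by (intro sums_mult) simp
  have "summable M"
    unfolding M_def
  proof (intro summable_mult summable_Cauchy_product)
    show "summable (\<lambda>k. norm (norm (a k) * (Q * norm z) ^ k))"
      using norm_summable[of "of_real (Q * norm z)"] Q by (simp add: norm_mult norm_power)
    show "summable (\<lambda>k. norm ((P * norm z) ^ k / fact k))"
      using exp_summable[of "of_real (P * norm z)"] P by (simp add: norm_mult norm_divide norm_power)
  qed
  moreover have "norm (t n s) \<le> M n" if s: "s \<in> {0..1}" for n s
  proof -
    have "norm (\<Sum>k\<le>n. (a k * (q s * z) ^ k) * ((p s * z) ^ (n - k) / fact (n - k)))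
      \<le> (\<Sum>k\<le>n. (norm (a k) * (Q * norm z) ^ k) * ((P * norm z) ^ (n - k) / fact (n - k)))"
    proof (intro sum_norm_le)
      fix k
      have "norm (q s * z) ^ k \<le> (Q * norm z) ^ k" "norm (p s * z) ^ (n - k) \<le> (P * norm z) ^ (n - k)"
        using Q(2)[OF s] P(2)[OF s]
        by (intro power_mono; simp add: norm_mult mult_right_mono)+
      then show "norm ((a k * (q s * z) ^ k) * ((p s * z) ^ (n - k) / fact (n - k)))
          \<le> (norm (a k) * (Q * norm z) ^ k) * ((P * norm z) ^ (n - k) / fact (n - k))"
        unfolding norm_mult[of "a k * _"] norm_mult[of "a k"] norm_divide norm_power norm_fact
        using Q(1) P(1) by (intro mult_mono divide_right_mono order_refl) auto
    qed
    then show ?thesis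
      unfolding t_def M_def norm_mult[of "w s"] using W(1) W(2)[OF s] by (intro mult_mono) auto
  qed
  ultimately have "uniform_limit {0..1} (\<lambda>n s. \<Sum>i<n. t i s) (\<lambda>s. \<Sum>i. t i s) sequentially"
    by (intro Weierstrass_m_test)
  also have "(\<lambda>s. \<Sum>i. t i s) = (\<lambda>s. w s * (f (q s * z) * exp (p s * z)))"
    using sums_unique[OF pointwise] by (simp add: fun_eq_iff)
  finally obtain I J where
    I: "\<And>n. ((\<lambda>s. \<Sum>i<n. t i s) has_integral I n) {0..1}"
    and J: "((\<lambda>s. w s * (f (q s * z) * exp (p s * z))) has_integral J) {0..1}"
    and IJ: "I \<longlonglongrightarrow> J"
    by (rule uniform_limit_integral)
       (auto simp: t_def intro!: continuous_intros p q w)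
  have t_integral: "(t n has_integral ?c n) {0..1}" for n
  proof -
    have "((\<lambda>s. \<Sum>k\<le>n. a k / fact (n - k) * (w s * q s ^ k * p s ^ (n - k)) * z ^ n)
        has_integral (\<Sum>k\<le>n. a k / fact (n - k)
          * integral {0..1} (\<lambda>s. w s * q s ^ k * p s ^ (n - k)) * z ^ n)) {0..1}"
      by (intro has_integral_sum has_integral_mult_left has_integral_mult_right
            integrable_integral integrable_continuous_real continuous_intros p q w) auto
    moreover have "(\<lambda>s. \<Sum>k\<le>n. a k / fact (n - k) * (w s * q s ^ k * p s ^ (n - k)) * z ^ n) = t n"
      unfolding t_def sum_distrib_left
    proof (intro ext sum.cong refl)
      fix s k assume "k \<in> {..n}"
      then have "z ^ n = z ^ k * z ^ (n - k)" by (simp flip: power_add)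
      then show "a k / fact (n - k) * (w s * q s ^ k * p s ^ (n - k)) * z ^ n
          = w s * (a k * (q s * z) ^ k * ((p s * z) ^ (n - k) / fact (n - k)))"
        by (simp add: power_mult_distrib)
    qed
    ultimately show ?thesis
      by (simp add: sum_distrib_right)
  qed
  have "I = (\<lambda>n. \<Sum>i<n. ?c i)"
    by (rule ext, rule has_integral_unique[OF I has_integral_sum]) (auto intro: t_integral)
  then show ?thesis
    using IJ integral_unique[OF J] by (simp add: sums_def)
qed

lemma deriv_power_series:
  fixes f :: "complex \<Rightarrow> complex"
  assumes f: "\<And>z. (\<lambda>n. a n * z ^ n) sums f z"
  shows "(\<lambda>n. (of_nat (Suc n) * a (Suc n)) * z ^ n) sums deriv f z"
proof -
  have summable: "summable (\<lambda>n. a n * z ^ n)" for z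
    using f[of z] by (rule sums_summable)
  have "(f has_field_derivative (\<Sum>n. diffs a n * z ^ n)) (at z)" for z
  proof -
    have "((\<lambda>z. \<Sum>n. a n * z ^ n) has_field_derivative (\<Sum>n. diffs a n * z ^ n)) (at z)"
      by (rule termdiffs_strong_converges_everywhere[OF summable])
    moreover have "(\<lambda>z. \<Sum>n. a n * z ^ n) = f"
      using sums_unique[OF f] by (simp add: fun_eq_iff)
    ultimately show ?thesis by simp
  qed
  then have "deriv f z = (\<Sum>n. diffs a n * z ^ n)" by (rule DERIV_imp_deriv)
  moreover have "summable (\<lambda>n. diffs a n * z ^ n)"
    by (rule termdiff_converges_all[OF summable])
  ultimately show ?thesis by (simp add: diffs_def summable_sums)
qed

lemma continuous_entire_compose:
  fixes f :: "complex \<Rightarrow> complex"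
  assumes "f holomorphic_on UNIV" "continuous_on S g"
  shows "continuous_on S (\<lambda>s. f (g s))"
  using continuous_on_compose2[OF holomorphic_on_imp_continuous_on[OF assms(1)] assms(2)] by auto

lemma sums_shift_times:
  fixes c :: "nat \<Rightarrow> complex"
  assumes "(\<lambda>n. c n * z ^ n) sums s"
  shows "(\<lambda>n. (case n of 0 \<Rightarrow> 0 | Suc m \<Rightarrow> c m) * z ^ n) sums (z * s)"
proof -
  have "(\<lambda>n. (case Suc n of 0 \<Rightarrow> 0 | Suc m \<Rightarrow> c m) * z ^ Suc n) sums (z * s)"
    using sums_mult[OF assms, of z] by (simp add: mult_ac)
  then show ?thesis
    by (subst (asm) sums_Suc_iff) simp
qed

lemma H0_factor:
  assumes "K \<in> H0"
  obtains k where "k holomorphic_on UNIV" "\<And>w. K w = w * k w"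
proof
  let ?k = "\<lambda>w. if w = 0 then deriv K 0 else K w / w"
  show "?k holomorphic_on UNIV"
    by (rule pole_theorem_0[of K _ 0]) (use assms in \<open>auto simp: H0_def\<close>)
  show "K w = w * ?k w" for w
    using assms by (simp add: H0_def)
qed

section \<open>Moments of the kernel and their recurrences\<close>

locale parameters =
  fixes x \<nu> :: complex
  assumes x_cut: "x \<notin> \<real>\<^sub>\<le>\<^sub>0" and x_neq_1: "x \<noteq> 1" and Re_nu: "Re \<nu> < 0"
begin

lemma x_nz: "x \<noteq> 0"
  using x_cut by auto

text \<open>
  The Taylor coefficients of \<open>Lop x \<nu> f\<close> are combinations of these integrals, with the power of
  the kernel equal to the index of the coefficient.
\<close>

definition moment :: "nat \<Rightarrow> nat \<Rightarrow> complex" where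
  "moment b l = integral {0..1} (\<lambda>\<zeta>. Rker x \<nu> \<zeta> ^ b * of_real \<zeta> ^ l)"

text \<open>
  The segment \<open>1 - (1 - x) \<zeta>\<close> runs from \<open>1\<close> to \<open>x\<close>. Since \<open>x\<close> lies off the closed negative
  half-axis, so does the segment, and principal powers of this base are smooth along it.
\<close>

lemma segment_avoids_cut:
  assumes "0 \<le> \<zeta>" "\<zeta> \<le> 1"
  shows "1 - (1 - x) * of_real \<zeta> \<notin> \<real>\<^sub>\<le>\<^sub>0"
proof
  assume "1 - (1 - x) * of_real \<zeta> \<in> \<real>\<^sub>\<le>\<^sub>0"
  then have re: "1 - \<zeta> + Re x * \<zeta> \<le> 0" and im: "Im x * \<zeta> = 0"
    by (auto simp: complex_nonpos_Reals_iff algebra_simps)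
  have "\<zeta> > 0" using assms re by (cases "\<zeta> = 0") auto
  then have "Im x = 0" using im by simp
  moreover have "Re x \<le> 0"
    using re assms \<open>\<zeta> > 0\<close> by (smt (verit) mult_pos_pos)
  ultimately show False
    using x_cut by (simp add: complex_nonpos_Reals_iff)
qed

lemma continuous_on_Rker: "continuous_on {0..1} (Rker x \<nu>)"
proof -
  have 1: "continuous_on {0..1} (\<lambda>\<zeta>::real. (1 - of_real \<zeta> :: complex) powr (- \<nu>))"
    by (intro continuous_on_powr_complex continuous_intros) (use Re_nu in auto)
  have 2: "continuous_on {0..1} (\<lambda>\<zeta>::real. (1 - (1 - x) * of_real \<zeta>) powr (\<nu> - 1))"
  proof (intro continuous_on_powr_complex continuous_intros)
    show "{0..1} \<subseteq> {\<zeta>. 0 \<le> Re (1 - (1 - x) * of_real \<zeta>) \<or> Im (1 - (1 - x) * of_real \<zeta>) \<noteq> 0}"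
      using segment_avoids_cut by (force simp: complex_nonpos_Reals_iff)
    show "0 < Re (\<nu> - 1)" if "\<zeta> \<in> {0..1}" "1 - (1 - x) * of_real \<zeta> = 0" for \<zeta>
      using segment_avoids_cut[of \<zeta>] that by auto
  qed
  show ?thesis
    unfolding Rker_def by (intro continuous_intros 1 2)
qed

lemma Rker_at_0: "Rker x \<nu> 0 = x"
  by (simp add: Rker_def)

lemma has_vector_derivative_Rker:
  assumes "0 < \<zeta>" "\<zeta> < 1"
  shows "(Rker x \<nu> has_vector_derivative
    Rker x \<nu> \<zeta> * (1 - x + \<nu> * x - (1 - x) * of_real \<zeta>)
      / ((1 - of_real \<zeta>) * (1 - (1 - x) * of_real \<zeta>))) (at \<zeta>)"
proof -
  define a where "a = 1 - complex_of_real \<zeta>"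
  define d where "d = 1 - (1 - x) * complex_of_real \<zeta>"
  have a: "a \<notin> \<real>\<^sub>\<le>\<^sub>0" "a \<noteq> 0"
    using assms by (auto simp: a_def complex_nonpos_Reals_iff complex_eq_iff)
  have d: "d \<notin> \<real>\<^sub>\<le>\<^sub>0" "d \<noteq> 0"
    using segment_avoids_cut[of \<zeta>] assms by (auto simp: d_def)
  have pw: "a powr (- \<nu> - 1) = a powr (- \<nu>) / a" "d powr (\<nu> - 2) = d powr (\<nu> - 1) / d"
    using a d powr_diff[of a "- \<nu>" 1] powr_diff[of d "\<nu> - 1" 1] by simp_all
  have "((\<lambda>w. x * (1 - w) powr (- \<nu>) * (1 - (1 - x) * w) powr (\<nu> - 1)) has_field_derivative
      x * a powr (- \<nu>) * d powr (\<nu> - 1) * (\<nu> / a - (\<nu> - 1) * (1 - x) / d)) (at (of_real \<zeta>))"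
    apply (rule derivative_eq_intros refl a[unfolded a_def] d[unfolded d_def])+
    apply (simp add: a_def[symmetric] d_def[symmetric] pw)
    using a(2) d(2) apply (simp add: divide_simps)
    apply (simp add: algebra_simps)
    done
  then have "(Rker x \<nu> has_vector_derivative
      x * a powr (- \<nu>) * d powr (\<nu> - 1) * (\<nu> / a - (\<nu> - 1) * (1 - x) / d)) (at \<zeta>)"
    unfolding Rker_def by (rule has_vector_derivative_real_field)
  moreover have "\<nu> / a - (\<nu> - 1) * (1 - x) / d
      = (1 - x + \<nu> * x - (1 - x) * of_real \<zeta>) / (a * d)"
    using a d by (simp add: field_simps) (simp add: a_def d_def algebra_simps)
  ultimately show ?thesis
    by (simp add: Rker_def a_def d_def)
qed

lemma moment_integrable:
  "((\<lambda>\<zeta>. Rker x \<nu> \<zeta> ^ b * of_real \<zeta> ^ l) has_integral moment b l) {0..1}"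
  unfolding moment_def
  by (intro integrable_integral integrable_continuous_real continuous_intros continuous_on_Rker)

text \<open>
  With \<open>D = (1 - \<zeta>)(1 - (1 - x)\<zeta>)\<close> the kernel satisfies \<open>D R' = (1 - x + \<nu> x - (1 - x)\<zeta>) R\<close>, so
  the derivative of \<open>D \<zeta>^l R^b\<close> is \<open>R^b\<close> times a polynomial with three terms. Integrating over
  \<open>[0,1]\<close> gives the recurrence; the factor \<open>D\<close> kills the boundary term at \<open>1\<close>, and at \<open>0\<close> a boundary
  term survives only for \<open>l = 0\<close>. The truncated \<open>l - 1\<close> is harmless, as its coefficient is \<open>0\<close> at \<open>l = 0\<close>.
\<close>

lemma moment_recurrence:
  "of_nat l * moment b (l - 1)
     + (of_nat b * (1 - x + \<nu> * x) - of_nat (l + 1) * (2 - x)) * moment b l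
     + (1 - x) * (of_nat l + 2 - of_nat b) * moment b (l + 1)
   = (if l = 0 then - (x ^ b) else 0)"
proof -
  define D where "D = (\<lambda>\<zeta>::real. (1 - of_real \<zeta>) * (1 - (1 - x) * of_real \<zeta>))"
  define D' where "D' = (\<lambda>\<zeta>::real. - (2 - x) + 2 * (1 - x) * of_real \<zeta>)"
  define E where "E = (\<lambda>\<zeta>::real. 1 - x + \<nu> * x - (1 - x) * of_real \<zeta>)"
  define F where "F = (\<lambda>\<zeta>. D \<zeta> * (of_real \<zeta> ^ l * Rker x \<nu> \<zeta> ^ b))"
  define G where "G = (\<lambda>\<zeta>::real. Rker x \<nu> \<zeta> ^ b *
     (D' \<zeta> * of_real \<zeta> ^ l + D \<zeta> * (of_nat l * of_real \<zeta> ^ (l - 1))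
       + of_nat b * E \<zeta> * of_real \<zeta> ^ l))"
  have D: "(D has_vector_derivative D' \<zeta>) (at \<zeta>)" for \<zeta>
    unfolding D_def D'_def
    by (auto intro!: derivative_eq_intros simp: algebra_simps)
  have "(F has_vector_derivative G \<zeta>) (at \<zeta>)" if "\<zeta> \<in> {0<..<1}" for \<zeta>
  proof -
    have z: "0 < \<zeta>" "\<zeta> < 1" using that by auto
    have "1 - complex_of_real \<zeta> \<noteq> 0" "1 - (1 - x) * of_real \<zeta> \<noteq> 0"
      using segment_avoids_cut[of \<zeta>] z by auto
    then have nz: "D \<zeta> \<noteq> 0"
      by (simp add: D_def)
    have R: "(Rker x \<nu> has_vector_derivative Rker x \<nu> \<zeta> * E \<zeta> / D \<zeta>) (at \<zeta>)"
      using has_vector_derivative_Rker[OF z] by (simp add: D_def E_def)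
    have Rb: "((\<lambda>\<zeta>. Rker x \<nu> \<zeta> ^ b) has_vector_derivative
        of_nat b * Rker x \<nu> \<zeta> ^ b * E \<zeta> / D \<zeta>) (at \<zeta>)"
    proof (cases b)
      case (Suc m)
      have "((\<lambda>w. w ^ b) has_field_derivative of_nat b * Rker x \<nu> \<zeta> ^ m) (at (Rker x \<nu> \<zeta>))"
        by (rule DERIV_cong[OF DERIV_power[OF DERIV_ident, of b]]) (simp add: Suc)
      from field_vector_diff_chain_at[OF R this] show ?thesis
        by (simp add: o_def Suc mult_ac)
    qed simp
    have zl: "((\<lambda>\<zeta>. of_real \<zeta> ^ l) has_vector_derivative
        of_nat l * complex_of_real \<zeta> ^ (l - 1)) (at \<zeta>)"
      by (rule has_vector_derivative_real_field) (auto intro!: derivative_eq_intros)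
    show ?thesis
      unfolding F_def G_def
      by (rule has_vector_derivative_eq_rhs[OF has_vector_derivative_mult[OF D
            has_vector_derivative_mult[OF zl Rb]]])
         (use nz in \<open>simp add: field_simps\<close>)
  qed
  moreover have "continuous_on {0..1} F"
    unfolding F_def D_def by (intro continuous_intros continuous_on_Rker)
  ultimately have "(G has_integral (F 1 - F 0)) {0..1}"
    by (intro fundamental_theorem_of_calculus_interior) auto
  then have G_integral: "(G has_integral (if l = 0 then - (x ^ b) else 0)) {0..1}"
    by (simp add: F_def D_def Rker_at_0 power_0_left split: if_splits)
  have G_eq: "G = (\<lambda>\<zeta>. of_nat l * (Rker x \<nu> \<zeta> ^ b * of_real \<zeta> ^ (l - 1))
     + (of_nat b * (1 - x + \<nu> * x) - of_nat (l + 1) * (2 - x)) * (Rker x \<nu> \<zeta> ^ b * of_real \<zeta> ^ l)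
     + (1 - x) * (of_nat l + 2 - of_nat b) * (Rker x \<nu> \<zeta> ^ b * of_real \<zeta> ^ (l + 1)))"
  proof
    fix \<zeta>
    define z where "z = complex_of_real \<zeta>"
    define r where "r = Rker x \<nu> \<zeta> ^ b"
    show "G \<zeta> = of_nat l * (Rker x \<nu> \<zeta> ^ b * of_real \<zeta> ^ (l - 1))
     + (of_nat b * (1 - x + \<nu> * x) - of_nat (l + 1) * (2 - x)) * (Rker x \<nu> \<zeta> ^ b * of_real \<zeta> ^ l)
     + (1 - x) * (of_nat l + 2 - of_nat b) * (Rker x \<nu> \<zeta> ^ b * of_real \<zeta> ^ (l + 1))"
    proof (cases l)
      case 0
      show ?thesis
        unfolding G_def D_def D'_def E_def z_def[symmetric] r_def[symmetric] 0
        by simp algebra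
    next
      case (Suc m)
      define y p B where y: "y = z ^ m" "p = complex_of_nat l" "B = complex_of_nat b"
      have z: "z ^ l = z * y" "z ^ (l + 1) = z * z * y" "z ^ (l - 1) = y"
        by (simp_all add: Suc y)
      show ?thesis
        unfolding G_def D_def D'_def E_def z_def[symmetric] r_def[symmetric] z of_nat_add of_nat_1
          y(2,3)[symmetric]
        by (simp add: algebra_simps)
    qed
  qed
  have "(G has_integral of_nat l * moment b (l - 1)
     + (of_nat b * (1 - x + \<nu> * x) - of_nat (l + 1) * (2 - x)) * moment b l
     + (1 - x) * (of_nat l + 2 - of_nat b) * moment b (l + 1)) {0..1}"
    unfolding G_eq
    by (intro has_integral_add has_integral_mult_right moment_integrable)
  from has_integral_unique[OF this G_integral] show ?thesis .
qed

text \<open>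
  Inside \<open>|u| < 1\<close> the power \<open>(1 - u) powr (1 - \<nu>)\<close> is holomorphic, and inside \<open>|u| < |x|\<close> the
  pole at \<open>u = x\<close> is avoided; a circle of this radius meets both requirements.
\<close>

definition radius :: real where
  "radius = min 1 (norm x) / 2"

lemma radius: "0 < radius" "radius < 1" "radius < norm x"
  using x_nz by (auto simp: radius_def min_def)

text \<open>
  The counterpart of \<open>moment\<close> for the inverse operator. The substitution \<open>\<zeta> = u / (u - x)\<close> turns
  \<open>(1 - u) powr (1 - \<nu>) / (u - x)\<close> into \<open>- 1 / R(\<zeta>)\<close> and \<open>du / (1 - u)\<close> into \<open>- x d\<zeta> / D\<close>, with
  \<open>D = (1 - \<zeta>)(1 - (1 - x)\<zeta>)\<close>. So this number is \<open>- x (-1)^k\<close> times the coefficient of \<open>\<zeta>^(l-1)\<close> in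
  \<open>R(\<zeta>)^(-k) / D\<close>.
\<close>

definition residue_moment :: "nat \<Rightarrow> nat \<Rightarrow> complex" where
  "residue_moment k l = 1 / (2 * of_real pi * \<i>) * contour_integral (circlepath 0 radius)
     (\<lambda>u. ((u - x) / u) ^ l * ((1 - u) powr (1 - \<nu>) / (u - x)) ^ k / (1 - u))"

lemma disc_avoids_cut: "norm (u::complex) < 1 \<Longrightarrow> 1 - u \<notin> \<real>\<^sub>\<le>\<^sub>0"
  using complex_Re_le_cmod[of u] by (auto simp: complex_nonpos_Reals_iff)

lemma residue_moment_integrable:
  "((\<lambda>u. ((u - x) / u) ^ l * ((1 - u) powr (1 - \<nu>) / (u - x)) ^ k / (1 - u))
     has_contour_integral (2 * of_real pi * \<i>) * residue_moment k l) (circlepath 0 radius)"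
proof -
  have "continuous_on (path_image (circlepath 0 radius))
    (\<lambda>u. ((u - x) / u) ^ l * ((1 - u) powr (1 - \<nu>) / (u - x)) ^ k / (1 - u))"
    using radius disc_avoids_cut
    by (intro continuous_intros continuous_on_powr_complex)
       (force simp: complex_nonpos_Reals_iff)+
  then have "(\<lambda>u. ((u - x) / u) ^ l * ((1 - u) powr (1 - \<nu>) / (u - x)) ^ k / (1 - u))
      contour_integrable_on circlepath 0 radius"
    by (rule contour_integrable_continuous_circlepath)
  then show ?thesis
    unfolding residue_moment_def by (simp add: has_contour_integral_integral)
qed

text \<open>
  The same idea as for \<open>moment_recurrence\<close>: the function \<open>v^l (Q / (u - x))^k\<close> with
  \<open>v = (u - x) / u\<close> and \<open>Q = (1 - u) powr (1 - \<nu>)\<close> is single-valued on the circle, so the integral of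
  its derivative vanishes. Now the coefficients are those of the adjoint of the recurrence for
  the moments when \<open>k = b\<close>, and they differ from it by multiples of \<open>b - k\<close> in general.
\<close>

lemma residue_moment_recurrence:
  assumes l: "l \<ge> 1"
  shows "of_nat l * residue_moment k (l + 1)
    = ((2 - x) * of_nat l - of_nat k * (1 - x + \<nu> * x)) * residue_moment k l
      - (1 - x) * (of_nat l - of_nat k) * residue_moment k (l - 1)"
proof -
  define W where "W = (\<lambda>l u. ((u - x) / u) ^ l * ((1 - u) powr (1 - \<nu>) / (u - x)) ^ k / (1 - u))"
  define V where "V = (\<lambda>u. x * (((u - x) / u) ^ l * ((1 - u) powr (1 - \<nu>) / (u - x)) ^ k))"
  define V' where "V' = (\<lambda>u. of_nat l * W (l + 1) u
      - ((2 - x) * of_nat l - of_nat k * (1 - x + \<nu> * x)) * W l u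
      + (1 - x) * (of_nat l - of_nat k) * W (l - 1) u)"
  have "(V has_field_derivative V' u) (at u)" if u: "u \<in> path_image (circlepath 0 radius)" for u
  proof -
    have nz: "u \<noteq> 0" "u - x \<noteq> 0" "1 - u \<noteq> 0" and cut: "1 - u \<notin> \<real>\<^sub>\<le>\<^sub>0"
      using u radius disc_avoids_cut[of u] by auto
    obtain m where m: "l = Suc m" using l by (cases l) auto
    define p where "p = (1 - u) powr (1 - \<nu>)"
    define g where "g = p / (u - x)"
    define v where "v = (u - x) / u"
    define h where "h = (1 - \<nu>) / (1 - u) + 1 / (u - x)"
    have pw: "(1 - u) powr (- \<nu>) = p / (1 - u)"
      using nz powr_diff[of "1 - u" "1 - \<nu>" 1] by (simp add: p_def)
    have dv: "((\<lambda>u. (u - x) / u) has_field_derivative x / u\<^sup>2) (at u)"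
      using nz by (auto intro!: derivative_eq_intros simp: field_simps power2_eq_square)
    have dg: "((\<lambda>u. (1 - u) powr (1 - \<nu>) / (u - x)) has_field_derivative
        - g * h) (at u)"
      unfolding h_def
      apply (rule derivative_eq_intros refl cut nz)+
      using nz apply (simp add: pw p_def[symmetric] g_def)
      apply (simp add: divide_simps)
      apply (simp add: algebra_simps)
      done
    have dgk: "((\<lambda>u. ((1 - u) powr (1 - \<nu>) / (u - x)) ^ k) has_field_derivative
        - of_nat k * g ^ k * h) (at u)"
    proof (cases k)
      case (Suc q)
      show ?thesis
        by (rule DERIV_cong[OF DERIV_power[OF dg, of k]])
           (simp add: Suc p_def[symmetric] g_def[symmetric] algebra_simps)
    qed simp
    have dvl: "((\<lambda>u. ((u - x) / u) ^ l) has_field_derivative of_nat l * v ^ m * (x / u\<^sup>2)) (at u)"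
      using DERIV_power[OF dv, of l] by (simp add: m v_def mult_ac)
    have "(V has_field_derivative x * (of_nat l * v ^ m * (x / u\<^sup>2) * g ^ k
        + v ^ l * (- of_nat k * g ^ k * h))) (at u)"
      unfolding V_def
      by (rule DERIV_cong[OF DERIV_cmult[OF DERIV_mult[OF dvl dgk]]])
         (simp add: v_def g_def p_def)
    moreover have "x * (of_nat l * v ^ m * (x / u\<^sup>2) * g ^ k
        + v ^ l * (- of_nat k * g ^ k * h))
      = v ^ m * g ^ k * (x * (of_nat l * (x / u\<^sup>2)
        - of_nat k * v * h))"
      by (simp add: m algebra_simps add_divide_distrib)
    \<comment> \<open>Substituting \<open>u = x / (1 - v)\<close> turns the numerator over \<open>1 - u\<close> into a quadratic polynomial in \<open>v\<close>.\<close>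
    moreover have "x * (of_nat l * (x / u\<^sup>2) - of_nat k * v * h)
      = (of_nat l * v\<^sup>2 - ((2 - x) * of_nat l - of_nat k * (1 - x + \<nu> * x)) * v
          + (1 - x) * (of_nat l - of_nat k)) / (1 - u)"
      unfolding v_def h_def using nz
      apply (simp add: divide_simps)
      apply (simp add: algebra_simps power2_eq_square)
      done
    moreover have "v ^ m * g ^ k * ((of_nat l * v\<^sup>2
          - ((2 - x) * of_nat l - of_nat k * (1 - x + \<nu> * x)) * v
          + (1 - x) * (of_nat l - of_nat k)) / (1 - u)) = V' u"
      unfolding V'_def W_def v_def[symmetric] p_def[symmetric] g_def[symmetric] using nz
      by (simp add: m divide_simps) (simp add: algebra_simps power2_eq_square)
    ultimately show ?thesis by (simp only:)
  qed
  then have "(V has_field_derivative V' u) (at u within path_image (circlepath 0 radius))"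
    if "u \<in> path_image (circlepath 0 radius)" for u
    using that has_field_derivative_at_within by blast
  from contour_integral_primitive[OF this, of "circlepath 0 radius"]
  have V'_0: "(V' has_contour_integral 0) (circlepath 0 radius)" by simp
  have V'_moments: "(V' has_contour_integral
      of_nat l * ((2 * of_real pi * \<i>) * residue_moment k (l + 1))
      - ((2 - x) * of_nat l - of_nat k * (1 - x + \<nu> * x)) * ((2 * of_real pi * \<i>) * residue_moment k l)
      + (1 - x) * (of_nat l - of_nat k) * ((2 * of_real pi * \<i>) * residue_moment k (l - 1)))
    (circlepath 0 radius)"
    unfolding V'_def W_def
    by (intro has_contour_integral_add has_contour_integral_diff has_contour_integral_lmul
          residue_moment_integrable)
  define c where "c = 2 * complex_of_real pi * \<i>"
  have "c * (of_nat l * residue_moment k (l + 1)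
      - ((2 - x) * of_nat l - of_nat k * (1 - x + \<nu> * x)) * residue_moment k l
      + (1 - x) * (of_nat l - of_nat k) * residue_moment k (l - 1)) = 0"
    using has_contour_integral_unique[OF V'_0 V'_moments]
    unfolding c_def[symmetric] by (simp add: algebra_simps)
  moreover have "c \<noteq> 0" by (simp add: c_def)
  ultimately have "of_nat l * residue_moment k (l + 1)
      - ((2 - x) * of_nat l - of_nat k * (1 - x + \<nu> * x)) * residue_moment k l
      + (1 - x) * (of_nat l - of_nat k) * residue_moment k (l - 1) = 0"
    by (simp only: mult_eq_0_iff) simp
  then show ?thesis
    by (simp only: eq_iff_diff_eq_0[of "of_nat l * _"]) (simp add: algebra_simps)
qed

lemma residue_moment_holomorphic:
  "(\<lambda>u. (u - x) ^ l * ((1 - u) powr (1 - \<nu>) / (u - x)) ^ k / (1 - u))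
     holomorphic_on ball 0 (min 1 (norm x))"
  using disc_avoids_cut by (intro holomorphic_intros) force+

lemma residue_moment_0: "residue_moment k 0 = 0"
proof -
  have "path_image (circlepath 0 radius) \<subseteq> ball (0::complex) (min 1 (norm x))"
    using radius by auto
  from Cauchy_theorem_disc_simple[OF residue_moment_holomorphic[of 0 k] _ this]
  show ?thesis
    unfolding residue_moment_def using contour_integral_unique by auto
qed

lemma residue_moment_1: "residue_moment k 1 = - x / (- x) ^ k"
proof -
  let ?f = "\<lambda>u. (u - x) ^ 1 * ((1 - u) powr (1 - \<nu>) / (u - x)) ^ k / (1 - u)"
  have "?f holomorphic_on cball 0 radius"
    by (rule holomorphic_on_subset[OF residue_moment_holomorphic]) (use radius in auto)
  from Cauchy_integral_circlepath_simple[OF this, of 0] radius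
  have "((\<lambda>u. ?f u / u) has_contour_integral 2 * of_real pi * \<i> * ?f 0) (circlepath 0 radius)"
    by simp
  moreover have "(\<lambda>u. ?f u / u)
      = (\<lambda>u. ((u - x) / u) ^ 1 * ((1 - u) powr (1 - \<nu>) / (u - x)) ^ k / (1 - u))"
    by (auto simp: fun_eq_iff)
  ultimately have "residue_moment k 1 = ?f 0"
    unfolding residue_moment_def using contour_integral_unique by fastforce
  then show ?thesis
    by (cases "even k") (simp_all add: power_divide)
qed

section \<open>Two mutually inverse triangular matrices\<close>

text \<open>
  Up to sign and a factorial this is the matrix entry of \<open>Lop x \<nu>\<close> with respect to the monomials:
  in the coefficient of \<open>z^b\<close> in the image of \<open>z^l\<close>, the summands with \<open>f\<close> and with \<open>z R f\<close> combine
  to the first term, and the summand with the derivative of \<open>f\<close> gives the second one.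
\<close>

definition coupled_moment :: "nat \<Rightarrow> nat \<Rightarrow> complex" where
  "coupled_moment b l = (1 - of_nat b + of_nat l) * moment b l
     - cpar x \<nu> * of_nat l * moment b (l - 1)"

lemma cpar_times: "(1 - x) * cpar x \<nu> = 1 - \<nu> * x"
  using x_neq_1 by (simp add: cpar_def)

text \<open>
  The Casorati determinant (the discrete Wronskian) of the two recurrences, in the form that
  appears when one of them is summed against a solution of the other.
\<close>

definition casorati :: "nat \<Rightarrow> nat \<Rightarrow> nat \<Rightarrow> complex" where
  "casorati b k l = (1 - x) * (of_nat l + 1 - of_nat b) * residue_moment k l * moment b l
     - of_nat l * residue_moment k (l + 1) * moment b (l - 1)"

text \<open>
  The discrete Lagrange identity. It expresses the products \<open>residue_moment * coupled_moment\<close>,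
  whose weighted sums are the entries of the matrix product, through neighbouring Casorati
  determinants; this is what makes those sums telescope.
\<close>

lemma casorati_step:
  "(of_nat b - of_nat (Suc l)) * casorati b k (Suc l) + (of_nat (Suc l) - of_nat k) * casorati b k l
    = (of_nat b - of_nat k) * (1 - x) * residue_moment k (Suc l) * coupled_moment b (Suc l)"
  if l: "l \<ge> 1"
proof -
  obtain c where c: "c = cpar x \<nu>" and cx: "(1 - x) * c = 1 - \<nu> * x"
    using cpar_times by blast
  define n0 n1 n2 where n: "n0 = residue_moment k l" "n1 = residue_moment k (Suc l)"
    "n2 = residue_moment k (Suc (Suc l))"
  define J0 J1 J2 where J: "J0 = moment b (l - Suc 0)" "J1 = moment b l" "J2 = moment b (Suc l)"
  define B K p where p: "B = complex_of_nat b" "K = complex_of_nat k" "p = complex_of_nat l"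
  have rn: "(p + 1) * n2 = ((2 - x) * (p + 1) - K * (1 - x + \<nu> * x)) * n1 - (1 - x) * (p + 1 - K) * n0"
    using residue_moment_recurrence[of "Suc l" k] by (simp add: n p add.commute)
  have rJ: "p * J0 + (B * (1 - x + \<nu> * x) - (p + 1) * (2 - x)) * J1 + (1 - x) * (p + 2 - B) * J2 = 0"
    using moment_recurrence[of l b] l by (simp add: J p add.commute)
  have "(B - (p + 1)) * ((1 - x) * (p + 1 + 1 - B) * n1 * J2 - (p + 1) * n2 * J1)
      + (p + 1 - K) * ((1 - x) * (p + 1 - B) * n0 * J1 - p * n1 * J0)
    = (B - K) * n1 * ((1 - x) * (1 - B + (p + 1)) * J2 - (1 - x) * c * (p + 1) * J1)"
    using rn rJ cx by algebra
  then show ?thesis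
    unfolding casorati_def coupled_moment_def c[symmetric]
    by (simp add: n[symmetric] J[symmetric] p[symmetric] algebra_simps)
qed

lemma casorati_start:
  assumes k: "k \<ge> 1"
  shows "casorati b k k = (1 - x) * residue_moment k k * coupled_moment b k"
proof -
  have "of_nat k * residue_moment k (k + 1) = of_nat k * (1 - \<nu> * x) * residue_moment k k"
    using residue_moment_recurrence[of k k] k by (simp add: algebra_simps)
  then have "casorati b k k = (1 - x) * (of_nat k + 1 - of_nat b) * residue_moment k k * moment b k
      - of_nat k * ((1 - x) * cpar x \<nu>) * residue_moment k k * moment b (k - 1)"
    by (simp add: casorati_def cpar_times)
  then show ?thesis
    by (simp add: coupled_moment_def algebra_simps)
qed

text \<open>
  For equal parameters the two recurrences are adjoint to each other, so the Casorati determinant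
  is constant in \<open>l\<close>. Its value comes from the inhomogeneous term of \<open>moment_recurrence\<close> at \<open>l = 0\<close>.
\<close>

lemma casorati_diagonal:
  assumes b: "b \<ge> 1" and l: "l \<ge> 1" "l \<le> b"
  shows "casorati b b l = x * (- 1) ^ b"
  using l
proof (induction l rule: dec_induct)
  case base
  have n2: "residue_moment b 2
      = ((2 - x) - of_nat b * (1 - x + \<nu> * x)) * residue_moment b 1"
    using residue_moment_recurrence[of 1 b] residue_moment_0[of b] by (simp add: numeral_2_eq_2)
  have rJ: "(of_nat b * (1 - x + \<nu> * x) - (2 - x)) * moment b 0
      + (1 - x) * (2 - of_nat b) * moment b 1 = - (x ^ b)"
    using moment_recurrence[of 0 b] by simp
  have "casorati b b 1 = residue_moment b 1 *
      ((of_nat b * (1 - x + \<nu> * x) - (2 - x)) * moment b 0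
        + (1 - x) * (2 - of_nat b) * moment b 1)"
    by (simp add: casorati_def n2[simplified numeral_2_eq_2] algebra_simps)
  also have "\<dots> = x * (x ^ b / (- x) ^ b)"
    unfolding rJ residue_moment_1 by simp
  also have "x ^ b / (- x) ^ b = (- 1) ^ b"
    using x_nz by (cases "even b") simp_all
  finally show ?case by simp
next
  case (step l)
  define n0 n1 n2 where n: "n0 = residue_moment b l" "n1 = residue_moment b (Suc l)"
    "n2 = residue_moment b (Suc (Suc l))"
  define J0 J1 J2 where J: "J0 = moment b (l - Suc 0)" "J1 = moment b l" "J2 = moment b (Suc l)"
  define B p where p: "B = complex_of_nat b" "p = complex_of_nat l"
  have rn: "(p + 1) * n2 = ((2 - x) * (p + 1) - B * (1 - x + \<nu> * x)) * n1 - (1 - x) * (p + 1 - B) * n0"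
    using residue_moment_recurrence[of "Suc l" b] by (simp add: n p add.commute)
  have rJ: "p * J0 + (B * (1 - x + \<nu> * x) - (p + 1) * (2 - x)) * J1 + (1 - x) * (p + 2 - B) * J2 = 0"
    using moment_recurrence[of l b] step.hyps by (simp add: J p add.commute)
  have "(1 - x) * (p + 1 + 1 - B) * n1 * J2 - (p + 1) * n2 * J1
      = (1 - x) * (p + 1 - B) * n0 * J1 - p * n1 * J0"
    using rn rJ by algebra
  then have "casorati b b (Suc l) = casorati b b l"
    by (simp add: casorati_def n[symmetric] J[symmetric] p[symmetric] add.commute)
  with step show ?case by simp
qed

text \<open>
  The matrices of the two operators on power series: \<open>L_coeff b l\<close> and \<open>M_coeff l k\<close> are the
  coefficients of \<open>z^b\<close> in the image of \<open>z^l\<close> and of \<open>z^l\<close> in the image of \<open>z^k\<close>. The formulas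
  are meant for \<open>l \<le> b\<close> and \<open>k \<le> l\<close>; the other entries of the two matrices are \<open>0\<close>.
\<close>

definition L_coeff :: "nat \<Rightarrow> nat \<Rightarrow> complex" where
  "L_coeff b l = (- 1) ^ (b - l) / fact (b - l) * coupled_moment b l"

definition M_coeff :: "nat \<Rightarrow> nat \<Rightarrow> complex" where
  "M_coeff l k = (1 - x) / x * (- 1) ^ k / fact (l - k) * residue_moment k l"

lemma L_M_coeff_diagonal:
  assumes "b \<ge> 1"
  shows "L_coeff b b * M_coeff b b = 1"
proof -
  have "L_coeff b b * M_coeff b b
      = (- 1) ^ b / x * ((1 - x) * residue_moment b b * coupled_moment b b)"
    by (simp add: L_coeff_def M_coeff_def)
  also have "(1 - x) * residue_moment b b * coupled_moment b b = x * (- 1) ^ b"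
    using casorati_start[OF assms, of b] casorati_diagonal[OF assms, of b] assms by simp
  finally show ?thesis
    using x_nz by (simp flip: power_mult_distrib)
qed

text \<open>
  Summation of \<open>casorati_step\<close> with binomial weights. The signs and factorials are such that the
  terms with \<open>casorati b k (l - 1)\<close> and \<open>casorati b k l\<close> cancel between consecutive summands.
\<close>

lemma L_M_coeff_partial_sum:
  assumes "k \<ge> 1" "k \<le> m" "m \<le> b"
  shows "(of_nat b - of_nat k) * (\<Sum>l=k..m. (- 1) ^ (b - l) / (fact (b - l) * fact (l - k))
      * ((1 - x) * residue_moment k l * coupled_moment b l))
    = (of_nat b - of_nat m) * ((- 1) ^ (b - m) / (fact (b - m) * fact (m - k))) * casorati b k m"
  using assms(2,3)
proof (induction m rule: dec_induct)
  case base
  then show ?case using casorati_start[OF assms(1), of b] by simp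
next
  case (step m)
  define W where "W = (\<lambda>l. (- 1) ^ (b - l) / (fact (b - l) * fact (l - k)) :: complex)"
  have W: "(of_nat b - of_nat m) * W m = - (of_nat (Suc m) - of_nat k) * W (Suc m)"
  proof -
    obtain i where i: "b = Suc m + i" using step.prems le_iff_add by blast
    obtain j where j: "m = k + j" using step.hyps le_iff_add by blast
    have "W m = - ((- 1) ^ i) / (of_nat (Suc i) * fact i * fact j)"
      by (simp add: W_def i j)
    moreover have "W (Suc m) = (- 1) ^ i / (fact i * (of_nat (Suc j) * fact j))"
      by (simp add: W_def i j Suc_diff_le)
    moreover have "of_nat b - of_nat m = (of_nat (Suc i) :: complex)"
      "of_nat (Suc m) - of_nat k = (of_nat (Suc j) :: complex)"
      by (simp_all add: i j)
    ultimately show ?thesis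
      by (simp del: of_nat_Suc)
  qed
  have IH: "(of_nat b - of_nat k) * (\<Sum>l=k..m. W l * ((1 - x) * residue_moment k l * coupled_moment b l))
      = (of_nat b - of_nat m) * W m * casorati b k m"
    using step.IH step.prems unfolding W_def by simp
  have "(of_nat b - of_nat k) * (\<Sum>l=k..Suc m. W l * ((1 - x) * residue_moment k l * coupled_moment b l))
      = (of_nat b - of_nat m) * W m * casorati b k m
        + W (Suc m) * ((of_nat b - of_nat k) * (1 - x) * residue_moment k (Suc m) * coupled_moment b (Suc m))"
    using step.hyps unfolding IH[symmetric] by (simp add: distrib_left mult_ac)
  also have "\<dots> = (of_nat b - of_nat (Suc m)) * W (Suc m) * casorati b k (Suc m)"
    unfolding W casorati_step[symmetric, of m, OF order_trans[OF assms(1) step.hyps(1)]]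
    by (simp add: algebra_simps)
  finally show ?case unfolding W_def .
qed

text \<open>
  Below the diagonal the sum vanishes because the closed form of \<open>L_M_coeff_partial_sum\<close> has the
  factor \<open>b - m\<close>, which is \<open>0\<close> for the full sum.
\<close>

lemma L_M_coeff_inverse:
  assumes "k \<ge> 1" "k \<le> b"
  shows "(\<Sum>l=k..b. L_coeff b l * M_coeff l k) = (if k = b then 1 else 0)"
proof (cases "k = b")
  case True
  then show ?thesis using L_M_coeff_diagonal assms by simp
next
  case False
  have "(\<Sum>l=k..b. L_coeff b l * M_coeff l k)
      = (- 1) ^ k / x * (\<Sum>l=k..b. (- 1) ^ (b - l) / (fact (b - l) * fact (l - k))
      * ((1 - x) * residue_moment k l * coupled_moment b l))"
    unfolding sum_distrib_left
    by (intro sum.cong) (simp_all add: L_coeff_def M_coeff_def mult_ac)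
  moreover have "(of_nat b - of_nat k :: complex) \<noteq> 0"
    using False by (metis eq_iff_diff_eq_0 of_nat_eq_iff)
  ultimately show ?thesis
    using L_M_coeff_partial_sum[OF assms(1,2) order_refl] False by simp
qed

section \<open>The operators on power series\<close>

lemma moment_weighted:
  assumes "k \<le> n"
  shows "integral {0..1} (\<lambda>s. Rker x \<nu> s ^ j * (of_real s * Rker x \<nu> s) ^ k * (- Rker x \<nu> s) ^ (n - k))
    = (- 1) ^ (n - k) * moment (n + j) k"
proof -
  have "(\<lambda>s. Rker x \<nu> s ^ j * (of_real s * Rker x \<nu> s) ^ k * (- Rker x \<nu> s) ^ (n - k))
    = (\<lambda>s. (- 1) ^ (n - k) * (Rker x \<nu> s ^ (n + j) * of_real s ^ k))"
  proof
    fix s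
    have "Rker x \<nu> s ^ (n + j) = Rker x \<nu> s ^ j * Rker x \<nu> s ^ k * Rker x \<nu> s ^ (n - k)"
      using assms by (simp flip: power_add add: add.commute)
    then show "Rker x \<nu> s ^ j * (of_real s * Rker x \<nu> s) ^ k * (- Rker x \<nu> s) ^ (n - k)
      = (- 1) ^ (n - k) * (Rker x \<nu> s ^ (n + j) * of_real s ^ k)"
      by (simp add: power_mult_distrib power_minus[of "Rker x \<nu> s"])
  qed
  then show ?thesis by (simp add: moment_def)
qed

lemma Lop_power_series:
  assumes f: "\<And>z. (\<lambda>n. a n * z ^ n) sums f z" and a0: "a 0 = 0"
  shows "(\<lambda>b. (\<Sum>l\<le>b. L_coeff b l * a l) * z ^ b) sums Lop x \<nu> f z"
proof -
  let ?R = "Rker x \<nu>"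
  have hol: "f holomorphic_on UNIV"
    using power_series_in_H0[OF f a0] by (simp add: H0_def)
  have hol': "deriv f holomorphic_on UNIV"
    using hol by (intro holomorphic_deriv) auto
  note f' = deriv_power_series[OF f]
  have cR: "continuous_on {0..1} (\<lambda>s. - ?R s)" "continuous_on {0..1} (\<lambda>s. of_real s * ?R s)"
    by (intro continuous_intros continuous_on_Rker)+
  have cj: "continuous_on {0..1} (\<lambda>s. ?R s ^ j)" for j
    by (intro continuous_intros continuous_on_Rker)
  have series: "(\<lambda>n. (\<Sum>k\<le>n. e k * ((- 1) ^ (n - k) * moment (n + j) k) / fact (n - k)) * z ^ n)
      sums integral {0..1} (\<lambda>s. ?R s ^ j * (g (of_real s * ?R s * z) * exp (- ?R s * z)))"
    if "\<And>z. (\<lambda>n. e n * z ^ n) sums g z" for e j and g :: "complex \<Rightarrow> complex"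
    using integral_times_exp_power_series[OF cR cj[of j] that, of z]
    by (simp add: moment_weighted)
  have cont: "continuous_on {0..1} (\<lambda>s. ?R s ^ j * (g (of_real s * ?R s * z) * exp (- ?R s * z)))"
    if "g holomorphic_on UNIV" for j g
    by (intro continuous_intros continuous_entire_compose[OF that] continuous_on_Rker)
  define I where "I = (\<lambda>j g. integral {0..1} (\<lambda>s. ?R s ^ j * (g (of_real s * ?R s * z) * exp (- ?R s * z))))"
  have "((\<lambda>s. ?R s ^ 0 * (f (of_real s * ?R s * z) * exp (- ?R s * z))
      + z * (?R s ^ 1 * (f (of_real s * ?R s * z) * exp (- ?R s * z)))
      - cpar x \<nu> * z * (?R s ^ 1 * (deriv f (of_real s * ?R s * z) * exp (- ?R s * z))))
      has_integral (I 0 f + z * I 1 f - cpar x \<nu> * z * I 1 (deriv f))) {0..1}"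
    unfolding I_def
    by (intro has_integral_add has_integral_diff has_integral_mult_right integrable_integral
          integrable_continuous_real cont hol hol')
  then have L: "Lop x \<nu> f z = I 0 f + z * I 1 f - cpar x \<nu> * z * I 1 (deriv f)"
    unfolding Lop_def
    by (intro integral_unique) (simp add: algebra_simps)
  define cA where "cA = (\<lambda>n. \<Sum>k\<le>n. a k * ((- 1) ^ (n - k) * moment n k) / fact (n - k))"
  define cB where "cB = (\<lambda>n. case n of 0 \<Rightarrow> 0 | Suc m \<Rightarrow>
    \<Sum>k\<le>m. a k * ((- 1) ^ (m - k) * moment (m + 1) k) / fact (m - k))"
  define cC where "cC = (\<lambda>n. case n of 0 \<Rightarrow> 0 | Suc m \<Rightarrow>
    \<Sum>k\<le>m. of_nat (Suc k) * a (Suc k) * ((- 1) ^ (m - k) * moment (m + 1) k) / fact (m - k))"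
  have "(\<lambda>n. cA n * z ^ n + cB n * z ^ n - cpar x \<nu> * (cC n * z ^ n))
    sums (I 0 f + z * I 1 f - cpar x \<nu> * (z * I 1 (deriv f)))"
    unfolding I_def cA_def cB_def cC_def
    by (intro sums_add sums_diff sums_mult sums_shift_times series f' f
          series[where j = 0, simplified add_0_right])
  moreover have coeff: "(\<Sum>l\<le>n. L_coeff n l * a l) = cA n + cB n - cpar x \<nu> * cC n" for n
  proof (cases n)
    case 0
    then show ?thesis using a0 by (simp add: cA_def cB_def cC_def)
  next
    case (Suc m)
    define A where "A = (\<lambda>k. a k * ((- 1) ^ (n - k) * moment n k) / fact (n - k))"
    define B where "B = (\<lambda>k. a k * ((- 1) ^ (m - k) * moment n k) / fact (m - k))"
    define C where "C = (\<lambda>k. of_nat (Suc k) * a (Suc k) * ((- 1) ^ (m - k) * moment n k) / fact (m - k))"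
    have AB: "B k = - (of_nat n - of_nat k) * A k" if k: "k \<le> m" for k
    proof -
      obtain i where i: "m = k + i" using k le_iff_add by blast
      have "A k = - (a k * ((- 1) ^ i * moment n k)) / (of_nat (Suc i) * fact i)"
        by (simp add: A_def i Suc Suc_diff_le)
      moreover have "of_nat n - of_nat k = (of_nat (Suc i) :: complex)" by (simp add: i Suc)
      ultimately show ?thesis by (simp add: B_def i Suc del: of_nat_Suc)
    qed
    \<comment> \<open>All three sums are brought to the index range of \<open>L_coeff n (Suc k)\<close>, \<open>k \<le> m\<close>; the terms with
      index \<open>0\<close> drop out since \<open>a 0 = 0\<close>.\<close>
    have "(\<Sum>k\<le>m. B k) = (\<Sum>k\<le>n. - (of_nat n - of_nat k) * A k)"
      unfolding Suc sum.atMost_Suc using AB by (simp add: Suc)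
    then have "(\<Sum>k\<le>n. A k) + (\<Sum>k\<le>m. B k) - cpar x \<nu> * (\<Sum>k\<le>m. C k)
        = (\<Sum>k\<le>n. (1 - of_nat n + of_nat k) * A k) - (\<Sum>k\<le>m. cpar x \<nu> * C k)"
      by (simp add: sum.distrib[symmetric] sum_distrib_left algebra_simps)
    also have "\<dots> = (\<Sum>k\<le>m. (1 - of_nat n + of_nat (Suc k)) * A (Suc k) - cpar x \<nu> * C k)"
      unfolding Suc by (subst sum.atMost_Suc_shift) (simp add: sum_subtractf A_def a0)
    also have "\<dots> = (\<Sum>k\<le>m. L_coeff n (Suc k) * a (Suc k))"
      by (intro sum.cong refl)
         (simp add: A_def C_def L_coeff_def coupled_moment_def Suc diff_divide_distrib add_divide_distrib algebra_simps)
    also have "\<dots> = (\<Sum>l\<le>n. L_coeff n l * a l)"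
      unfolding Suc by (subst sum.atMost_Suc_shift) (simp add: a0)
    finally show ?thesis by (simp add: A_def B_def C_def cA_def cB_def cC_def Suc)
  qed
  ultimately show ?thesis
    unfolding coeff L by (simp add: algebra_simps)
qed

text \<open>
  The candidate for the inverse: the loop integral of the theorem after the substitution \<open>t = 1 / u\<close>,
  with the prefactor \<open>exp z\<close> moved under the integral and the contour contracted to a small circle.
  In this form the exponent is \<open>z (u - x) / u\<close>, and the Taylor coefficients can be read off.
\<close>

definition M_op :: "(complex \<Rightarrow> complex) \<Rightarrow> complex \<Rightarrow> complex" where
  "M_op K z = (1 - x) / (2 * of_real pi * \<i> * x) * contour_integral (circlepath 0 radius)
     (\<lambda>u. exp ((u - x) / u * z) * K (- ((1 - u) powr (1 - \<nu>) / u) * z) / (1 - u))"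

lemma M_op_power_series:
  assumes K: "\<And>z. (\<lambda>n. a n * z ^ n) sums K z"
  shows "(\<lambda>n. (\<Sum>k\<le>n. M_coeff n k * a k) * z ^ n) sums M_op K z"
proof -
  define \<gamma> where "\<gamma> = circlepath (0::complex) radius"
  define \<gamma>' where "\<gamma>' s = vector_derivative \<gamma> (at s)" for s
  have nz: "\<gamma> s \<noteq> 0" "\<gamma> s - x \<noteq> 0" "1 - \<gamma> s \<noteq> 0" "norm (\<gamma> s) < 1" if "s \<in> {0..1}" for s
  proof -
    have "norm (\<gamma> s) = radius"
      using radius by (simp add: \<gamma>_def circlepath norm_mult)
    then show "\<gamma> s \<noteq> 0" "\<gamma> s - x \<noteq> 0" "1 - \<gamma> s \<noteq> 0" "norm (\<gamma> s) < 1"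
      using radius by auto
  qed
  have c\<gamma>: "continuous_on {0..1} \<gamma>"
    unfolding \<gamma>_def circlepath by (intro continuous_intros)
  have c\<gamma>': "continuous_on {0..1} \<gamma>'"
    unfolding \<gamma>_def \<gamma>'_def vector_derivative_circlepath by (intro continuous_intros)
  define p where "p = (\<lambda>s. (\<gamma> s - x) / \<gamma> s)"
  define q where "q = (\<lambda>s. - ((1 - \<gamma> s) powr (1 - \<nu>) / \<gamma> s))"
  define w where "w = (\<lambda>s. \<gamma>' s / (1 - \<gamma> s))"
  have cpow: "continuous_on {0..1} (\<lambda>s. (1 - \<gamma> s) powr (1 - \<nu>))"
    using disc_avoids_cut nz(4)
    by (intro continuous_on_powr_complex continuous_intros c\<gamma>)
       (force simp: complex_nonpos_Reals_iff)+
  have cont: "continuous_on {0..1} p" "continuous_on {0..1} q" "continuous_on {0..1} w"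
    unfolding p_def q_def w_def using nz
    by (auto intro!: continuous_on_minus continuous_on_divide continuous_on_diff c\<gamma> c\<gamma>' cpow)
  have residue: "integral {0..1} (\<lambda>s. w s * q s ^ k * p s ^ (n - k))
      = (2 * of_real pi * \<i>) * ((- 1) ^ k * residue_moment k n)" if k: "k \<le> n" for n k
  proof -
    have "integral {0..1} (\<lambda>s. w s * q s ^ k * p s ^ (n - k))
      = integral {0..1} (\<lambda>s. (- 1) ^ k *
          (((\<gamma> s - x) / \<gamma> s) ^ n * ((1 - \<gamma> s) powr (1 - \<nu>) / (\<gamma> s - x)) ^ k / (1 - \<gamma> s) * \<gamma>' s))"
    proof (rule integral_cong)
      fix s :: real assume s: "s \<in> {0..1}"
      define Q where "Q = (1 - \<gamma> s) powr (1 - \<nu>)"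
      have "((\<gamma> s - x) / \<gamma> s) ^ n = p s ^ k * p s ^ (n - k)"
        using k by (simp add: p_def flip: power_add)
      \<comment> \<open>Here \<open>Q / \<gamma> s = p s * (Q / (\<gamma> s - x))\<close>, which shifts \<open>k\<close> powers of \<open>p\<close>.\<close>
      moreover have "q s ^ k = (- 1) ^ k * (p s ^ k * (Q / (\<gamma> s - x)) ^ k)"
        using nz[OF s] unfolding power_mult_distrib[symmetric] by (simp add: q_def p_def Q_def)
      ultimately show "w s * q s ^ k * p s ^ (n - k) = (- 1) ^ k *
          (((\<gamma> s - x) / \<gamma> s) ^ n * ((1 - \<gamma> s) powr (1 - \<nu>) / (\<gamma> s - x)) ^ k / (1 - \<gamma> s) * \<gamma>' s)"
        by (simp add: w_def Q_def)
    qed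
    also have "\<dots> = (- 1) ^ k * contour_integral \<gamma>
        (\<lambda>u. ((u - x) / u) ^ n * ((1 - u) powr (1 - \<nu>) / (u - x)) ^ k / (1 - u))"
      unfolding contour_integral_integral \<gamma>'_def by (rule integral_mult_right)
    finally show ?thesis
      by (simp add: residue_moment_def \<gamma>_def)
  qed
  have "(\<lambda>n. (1 - x) / (2 * of_real pi * \<i> * x) *
      ((\<Sum>k\<le>n. a k * integral {0..1} (\<lambda>s. w s * q s ^ k * p s ^ (n - k)) / fact (n - k)) * z ^ n))
    sums ((1 - x) / (2 * of_real pi * \<i> * x)
      * integral {0..1} (\<lambda>s. w s * (K (q s * z) * exp (p s * z))))"
    by (intro sums_mult integral_times_exp_power_series cont K)
  moreover have "(1 - x) / (2 * of_real pi * \<i> * x) *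
      ((\<Sum>k\<le>n. a k * integral {0..1} (\<lambda>s. w s * q s ^ k * p s ^ (n - k)) / fact (n - k)) * z ^ n)
    = (\<Sum>k\<le>n. M_coeff n k * a k) * z ^ n" for n
  proof -
    have "(1 - x) / (2 * of_real pi * \<i> * x) *
      (\<Sum>k\<le>n. a k * integral {0..1} (\<lambda>s. w s * q s ^ k * p s ^ (n - k)) / fact (n - k))
      = (\<Sum>k\<le>n. M_coeff n k * a k)"
      unfolding sum_distrib_left
      by (intro sum.cong refl) (simp add: residue M_coeff_def)
    then show ?thesis by (simp only: mult.assoc[symmetric])
  qed
  moreover have "integral {0..1} (\<lambda>s. w s * (K (q s * z) * exp (p s * z)))
      = contour_integral (circlepath 0 radius)
     (\<lambda>u. exp ((u - x) / u * z) * K (- ((1 - u) powr (1 - \<nu>) / u) * z) / (1 - u))"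
    unfolding contour_integral_integral
    by (intro integral_cong)
       (simp add: w_def q_def p_def \<gamma>_def \<gamma>'_def mult_ac)
  ultimately show ?thesis
    by (simp add: M_op_def)
qed

lemma Lop_in_H0: "f \<in> H0 \<Longrightarrow> Lop x \<nu> f \<in> H0"
proof (erule H0_power_series)
  fix a assume "\<And>z. (\<lambda>n. a n * z ^ n) sums f z" "a 0 = 0"
  from Lop_power_series[OF this] this(2) show ?thesis
    by (intro power_series_in_H0[where a = "\<lambda>b. \<Sum>l\<le>b. L_coeff b l * a l"]) auto
qed

lemma M_op_in_H0: "K \<in> H0 \<Longrightarrow> M_op K \<in> H0"
proof (erule H0_power_series)
  fix a assume a: "\<And>z. (\<lambda>n. a n * z ^ n) sums K z" "a 0 = 0"
  from M_op_power_series[OF a(1)] a(2) show ?thesis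
    by (intro power_series_in_H0[where a = "\<lambda>n. \<Sum>k\<le>n. M_coeff n k * a k"]) auto
qed

lemma Lop_M_op:
  assumes "K \<in> H0"
  shows "Lop x \<nu> (M_op K) = K"
proof
  fix z
  obtain a where a: "\<And>z. (\<lambda>n. a n * z ^ n) sums K z" "a 0 = 0"
    using H0_power_series[OF assms] by metis
  have "(\<Sum>l\<le>b. L_coeff b l * (\<Sum>k\<le>l. M_coeff l k * a k)) = a b" for b
  proof -
    have "(\<Sum>l\<le>b. L_coeff b l * (\<Sum>k\<le>l. M_coeff l k * a k))
        = (\<Sum>l\<le>b. \<Sum>k | k \<in> {..b} \<and> k \<le> l. L_coeff b l * M_coeff l k * a k)"
      unfolding sum_distrib_left by (intro sum.cong) (auto simp: mult.assoc)
    also have "\<dots> = (\<Sum>k\<le>b. \<Sum>l | l \<in> {..b} \<and> k \<le> l. L_coeff b l * M_coeff l k * a k)"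
      by (rule sum.swap_restrict) auto
    also have "\<dots> = (\<Sum>k\<le>b. (if k = b then a b else 0))"
    proof (intro sum.cong refl)
      fix k assume "k \<in> {..b}"
      have "(\<Sum>l | l \<in> {..b} \<and> k \<le> l. L_coeff b l * M_coeff l k * a k)
          = (\<Sum>l=k..b. L_coeff b l * M_coeff l k) * a k"
        unfolding sum_distrib_right by (intro sum.cong) auto
      then show "(\<Sum>l | l \<in> {..b} \<and> k \<le> l. L_coeff b l * M_coeff l k * a k)
          = (if k = b then a b else 0)"
        using L_M_coeff_inverse[of k b] \<open>k \<in> {..b}\<close> a(2) by (cases "k = 0") auto
    qed
    also have "\<dots> = a b" by simp
    finally show ?thesis .
  qed
  with Lop_power_series[OF M_op_power_series[OF a(1)], of z] a(2)
  have "(\<lambda>b. a b * z ^ b) sums Lop x \<nu> (M_op K) z" by simp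
  then show "Lop x \<nu> (M_op K) z = K z"
    using a(1) sums_unique2 by blast
qed

text \<open>
  The matrix of \<open>Lop x \<nu>\<close> is triangular, and by \<open>L_M_coeff_diagonal\<close> its diagonal entries are
  nonzero from index \<open>1\<close> on; so the coefficients of \<open>f\<close> are determined one after the other.
\<close>

lemma Lop_inj_on_H0: "inj_on (Lop x \<nu>) H0"
proof (rule inj_onI)
  fix f g assume "f \<in> H0" "g \<in> H0" and eq: "Lop x \<nu> f = Lop x \<nu> g"
  obtain a where a: "\<And>z. (\<lambda>n. a n * z ^ n) sums f z" "a 0 = 0"
    using H0_power_series[OF \<open>f \<in> H0\<close>] by metis
  obtain d where d: "\<And>z. (\<lambda>n. d n * z ^ n) sums g z" "d 0 = 0"
    using H0_power_series[OF \<open>g \<in> H0\<close>] by metis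
  have coeffs: "(\<lambda>b. \<Sum>l\<le>b. L_coeff b l * a l) = (\<lambda>b. \<Sum>l\<le>b. L_coeff b l * d l)"
    by (rule entire_coeffs_unique[where f = "Lop x \<nu> f"])
       (use Lop_power_series[OF a] Lop_power_series[OF d] eq in auto)
  have "a b = d b" for b
  proof (induction b rule: less_induct)
    case (less b)
    show ?case
    proof (cases b)
      case 0
      then show ?thesis using a(2) d(2) by simp
    next
      case (Suc m)
      have "(\<Sum>l\<le>m. L_coeff b l * a l) = (\<Sum>l\<le>m. L_coeff b l * d l)"
        using less.IH Suc by (intro sum.cong) auto
      then have "L_coeff b b * a b = L_coeff b b * d b"
        using fun_cong[OF coeffs, of b] by (simp add: Suc)
      moreover have "L_coeff b b \<noteq> 0"
        using L_M_coeff_diagonal[of b] Suc by auto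
      ultimately show ?thesis by simp
    qed
  qed
  then have "a = d" by blast
  then show "f = g" using a(1) d(1) sums_unique2 by blast
qed

lemma Lop_bij_betw: "bij_betw (Lop x \<nu>) H0 H0"
  unfolding bij_betw_def
proof
  show "Lop x \<nu> ` H0 = H0"
    using Lop_in_H0 M_op_in_H0 Lop_M_op by (metis image_eqI image_subsetI subsetI subset_antisym)
qed (rule Lop_inj_on_H0)

lemma inv_into_Lop: "K \<in> H0 \<Longrightarrow> inv_into H0 (Lop x \<nu>) K = M_op K"
  using inv_into_f_f[OF Lop_inj_on_H0 M_op_in_H0] Lop_M_op by metis

end

section \<open>Loops from 1 around 0\<close>

text \<open>
  Near \<open>a\<close> the derivative of the primitive is bounded, so on the convex set the primitive is
  Lipschitz and extends continuously to \<open>a\<close>.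
\<close>

lemma primitive_tendsto_boundary_point:
  fixes F G :: "complex \<Rightarrow> complex"
  assumes H: "convex H" "a \<in> closure H"
    and G: "\<And>w. w \<in> H \<Longrightarrow> (G has_field_derivative F w) (at w)"
    and F: "continuous_on (insert a H) F"
  obtains l where "(G \<longlongrightarrow> l) (at a within H)"
proof -
  obtain \<delta> where \<delta>: "\<delta> > 0" "\<And>w. w \<in> insert a H \<Longrightarrow> dist w a < \<delta> \<Longrightarrow> dist (F w) (F a) < 1"
    using F unfolding continuous_on_iff by (metis insertI1 zero_less_one)
  define H' where "H' = H \<inter> ball a \<delta>"
  define B where "B = norm (F a) + 1"
  have "norm (F w) \<le> B" if "w \<in> H'" for w
    using \<delta>(2)[of w] that norm_triangle_sub[of "F w" "F a"]
    by (auto simp: H'_def B_def dist_norm norm_minus_commute)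
  then have lip: "norm (G u - G v) \<le> B * norm (u - v)" if "u \<in> H'" "v \<in> H'" for u v
    using that G H(1)
    by (intro field_differentiable_bound[of H' G F])
       (auto simp: H'_def convex_Int intro: has_field_derivative_at_within)
  have "B-lipschitz_on H' G"
    by (rule lipschitz_onI) (use lip in \<open>auto simp: dist_norm B_def\<close>)
  then have "uniformly_continuous_on H' G"
    by (rule lipschitz_on_uniformly_continuous)
  moreover have "a \<in> closure H'"
    using H(2) \<delta>(1) open_Int_closure_subset[of "ball a \<delta>" H] by (auto simp: H'_def Int_commute)
  ultimately obtain l where "(G \<longlongrightarrow> l) (at a within H')"
    by (rule uniformly_continuous_on_extension_at_closure)
  moreover have "at a within H' = at a within H"
    by (rule at_within_nhd[of a "ball a \<delta>"]) (use \<delta> in \<open>auto simp: H'_def\<close>)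
  ultimately show ?thesis using that by simp
qed

text \<open>
  On the starlike slit plane \<open>F\<close> has a primitive \<open>G\<close>. An admissible loop leaves \<open>1\<close> through the upper
  half-plane and returns through the lower one, so the integral along it is the difference of the
  limits of \<open>G\<close> at \<open>1\<close> from below and from above the slit, whichever loop is taken. The path may have
  infinite length near its base point, hence the integral is obtained from the fundamental
  theorem of calculus for a function that is only continuous at the end points.
\<close>

lemma contour_integral_loop_from_1_indep:
  assumes hol: "F holomorphic_on - \<real>\<^sub>\<ge>\<^sub>0" and cont: "continuous_on (insert 1 (- \<real>\<^sub>\<ge>\<^sub>0)) F"
  obtains I where "\<And>\<gamma>. loop_from_1_around_0 \<gamma> \<Longrightarrow> (F has_contour_integral I) \<gamma>"
proof -
  define U where "U = - (\<real>\<^sub>\<ge>\<^sub>0 :: complex set)"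
  have "open U" by (auto simp: U_def)
  have "\<real>\<^sub>\<ge>\<^sub>0 = complex_of_real ` {0..}"
    by (auto simp: nonneg_Reals_def)
  then have "starlike U"
    using starlike_slotted_complex_plane_right[of 0] by (simp add: U_def)
  have "\<exists>G. \<forall>w\<in>U. (G has_field_derivative F w) (at w)"
    using hol \<open>open U\<close> \<open>starlike U\<close>
    by (intro holomorphic_starlike_primitive[of U F "{}"] holomorphic_on_imp_continuous_on)
       (auto simp: U_def holomorphic_on_imp_differentiable_at)
  then obtain G where G: "\<And>w. w \<in> U \<Longrightarrow> (G has_field_derivative F w) (at w)" by blast
  have clo: "1 \<in> closure {w. Im w > 0}" "1 \<in> closure {w. Im w < 0}"
  proof -
    have "\<exists>y. 0 < Im y \<and> dist y 1 < e" "\<exists>y. Im y < 0 \<and> dist y 1 < e" if "e > 0" for e :: real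
      using that
      by (intro exI[of _ "Complex 1 (e / 2)"] exI[of _ "Complex 1 (- (e / 2))"];
          simp add: dist_norm cmod_def)+
    then show "1 \<in> closure {w. Im w > 0}" "1 \<in> closure {w. Im w < 0}"
      by (auto simp: closure_approachable)
  qed
  have halfplanes: "{w. Im w > 0} \<subseteq> U" "{w. Im w < 0} \<subseteq> U"
    by (auto simp: U_def complex_nonneg_Reals_iff)
  obtain lu where lu: "(G \<longlongrightarrow> lu) (at 1 within {w. Im w > 0})"
  proof (rule primitive_tendsto_boundary_point)
    show "continuous_on (insert 1 {w. Im w > 0}) F"
      by (rule continuous_on_subset[OF cont]) (use halfplanes in \<open>auto simp: U_def\<close>)
  qed (use halfplanes G clo convex_halfspace_Im_gt in auto)
  obtain ld where ld: "(G \<longlongrightarrow> ld) (at 1 within {w. Im w < 0})"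
  proof (rule primitive_tendsto_boundary_point)
    show "continuous_on (insert 1 {w. Im w < 0}) F"
      by (rule continuous_on_subset[OF cont]) (use halfplanes in \<open>auto simp: U_def\<close>)
  qed (use halfplanes G clo convex_halfspace_Im_lt in auto)
  have "(F has_contour_integral (ld - lu)) \<gamma>" if "loop_from_1_around_0 \<gamma>" for \<gamma>
  proof -
    have \<gamma>: "valid_path \<gamma>" "simple_path \<gamma>" "\<gamma> 0 = 1" "\<gamma> 1 = 1"
      "path_image \<gamma> \<inter> \<real>\<^sub>\<ge>\<^sub>0 = {1}"
      "\<forall>\<^sub>F s in at_right 0. Im (\<gamma> s) > 0" "\<forall>\<^sub>F s in at_left 1. Im (\<gamma> s) < 0"
      using that by (auto simp: loop_from_1_around_0_def pathstart_def pathfinish_def)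
    have c\<gamma>: "continuous_on {0..1} \<gamma>"
      using \<gamma>(2) by (simp add: simple_path_def path_def)
    have inU: "\<gamma> s \<in> U" if "0 < s" "s < 1" for s
    proof (rule ccontr)
      assume "\<gamma> s \<notin> U"
      then have "\<gamma> s \<in> path_image \<gamma> \<inter> \<real>\<^sub>\<ge>\<^sub>0" using that by (auto simp: U_def path_image_def)
      then have "\<gamma> s = \<gamma> 0" using \<gamma>(3,5) by auto
      then show False
        using \<gamma>(2) that unfolding simple_path_def loop_free_def by force
    qed
    define g where "g = (\<lambda>s. if s = 0 then lu else if s = 1 then ld else G (\<gamma> s))"
    obtain S where S: "finite S" "\<gamma> C1_differentiable_on ({0..1} - S)"
      using \<gamma>(1) by (auto simp: valid_path_def piecewise_C1_differentiable_on_def)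
    have "(g has_vector_derivative F (\<gamma> s) * vector_derivative \<gamma> (at s)) (at s)"
      if s: "s \<in> {0<..<1} - S" for s
    proof -
      have "(\<gamma> has_vector_derivative vector_derivative \<gamma> (at s)) (at s)"
        using S(2) s by (simp add: C1_differentiable_on_eq vector_derivative_works)
      from field_vector_diff_chain_at[OF this G[OF inU]] s
      have "((G \<circ> \<gamma>) has_vector_derivative vector_derivative \<gamma> (at s) * F (\<gamma> s)) (at s)"
        by auto
      then show ?thesis
        by (rule has_vector_derivative_transform_within_open[where S = "{0<..<1}", THEN
              has_vector_derivative_eq_rhs])
           (use s in \<open>auto simp: g_def mult.commute\<close>)
    qed
    moreover have "continuous_on {0..1} g"
      unfolding continuous_on_def
    proof
      fix s :: real assume s: "s \<in> {0..1}"
      consider "s = 0" | "s = 1" | "0 < s" "s < 1" using s by force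
      then show "(g \<longlongrightarrow> g s) (at s within {0..1})"
      proof cases
        case 1
        have "(\<gamma> \<longlongrightarrow> 1) (at_right 0)"
          using c\<gamma> \<gamma>(3) by (auto simp: continuous_on_def at_within_Icc_at_right dest: bspec[of _ _ 0])
        then have "filterlim \<gamma> (at 1 within {w. Im w > 0}) (at_right 0)"
          using \<gamma>(6) by (auto simp: filterlim_at elim!: eventually_mono)
        from filterlim_compose[OF lu this] have "((\<lambda>s. G (\<gamma> s)) \<longlongrightarrow> lu) (at_right 0)" .
        moreover have "\<forall>\<^sub>F s in at_right 0. G (\<gamma> s) = g s"
          unfolding eventually_at_right_field g_def by (intro exI[of _ 1]) auto
        ultimately have "(g \<longlongrightarrow> lu) (at_right 0)" by (rule Lim_transform_eventually)
        then show ?thesis using 1 by (simp add: g_def at_within_Icc_at_right)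
      next
        case 2
        have "(\<gamma> \<longlongrightarrow> 1) (at_left 1)"
          using c\<gamma> \<gamma>(4) by (auto simp: continuous_on_def at_within_Icc_at_left dest: bspec[of _ _ 1])
        then have "filterlim \<gamma> (at 1 within {w. Im w < 0}) (at_left 1)"
          using \<gamma>(7) by (auto simp: filterlim_at elim!: eventually_mono)
        from filterlim_compose[OF ld this] have "((\<lambda>s. G (\<gamma> s)) \<longlongrightarrow> ld) (at_left 1)" .
        moreover have "\<forall>\<^sub>F s in at_left 1. G (\<gamma> s) = g s"
          unfolding eventually_at_left_field g_def by (intro exI[of _ 0]) auto
        ultimately have "(g \<longlongrightarrow> ld) (at_left 1)" by (rule Lim_transform_eventually)
        then show ?thesis using 2 by (simp add: g_def at_within_Icc_at_left)
      next
        case 3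
        have "isCont \<gamma> s"
          using c\<gamma> 3 by (intro continuous_on_interior[of "{0..1}"]) auto
        moreover have "isCont G (\<gamma> s)" using G[OF inU] 3 DERIV_isCont by blast
        ultimately have "isCont (\<lambda>s. G (\<gamma> s)) s" by (rule isCont_o2)
        then have "((\<lambda>s. G (\<gamma> s)) \<longlongrightarrow> G (\<gamma> s)) (at s)" by (simp add: isCont_def)
        then have "(g \<longlongrightarrow> G (\<gamma> s)) (at s)"
          by (rule Lim_transform_within_open[of _ _ _ _ "{0<..<1}"]) (use 3 in \<open>auto simp: g_def\<close>)
        then show ?thesis
          using 3 by (auto simp: g_def intro: tendsto_within_subset)
      qed
    qed
    ultimately have "((\<lambda>s. F (\<gamma> s) * vector_derivative \<gamma> (at s)) has_integral (g 1 - g 0)) {0..1}"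
      by (intro fundamental_theorem_of_calculus_interior_strong[OF S(1)]) auto
    then show ?thesis
      by (simp add: has_contour_integral g_def)
  qed
  then show ?thesis using that by blast
qed

text \<open>
  The two multivalued factors combine to one that is single-valued in the unit disc punctured at
  \<open>0\<close>. For the principal branches this needs \<open>Ln (1 - 1/u) = Ln (-1/u) + Ln (1 - u)\<close>, which holds because
  the imaginary parts of the two logarithms on the right have opposite signs or both vanish.
\<close>

lemma powr_reciprocal:
  fixes u :: complex
  assumes "u \<notin> \<real>\<^sub>\<ge>\<^sub>0"
  shows "(- inverse u) powr \<nu> * (1 - inverse u) powr (1 - \<nu>) = - ((1 - u) powr (1 - \<nu>) / u)"
proof -
  have nz: "u \<noteq> 0" "1 - u \<noteq> 0" "1 - inverse u \<noteq> 0"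
    using assms by (auto simp: field_simps)
  have im: "Im (- inverse u) = Im u / (norm u)\<^sup>2"
    by (simp add: cmod_power2)
  have "- pi < Im (Ln (- inverse u)) + Im (Ln (1 - u)) \<and>
      Im (Ln (- inverse u)) + Im (Ln (1 - u)) \<le> pi"
  proof (cases "Im u" "0::real" rule: linorder_cases)
    case greater
    then have "Im (- inverse u) > 0" using nz im by simp
    then have "0 < Im (Ln (- inverse u))" "Im (Ln (- inverse u)) < pi"
      using Im_Ln_pos_lt_imp nz by (auto simp: Im_Ln_pos_lt)
    moreover have "- pi < Im (Ln (1 - u))" "Im (Ln (1 - u)) < 0"
      using greater nz mpi_less_Im_Ln[of "1 - u"] Im_Ln_pos_le[of "1 - u"] Im_Ln_le_pi[of "1 - u"] by auto
    ultimately show ?thesis by linarith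
  next
    case less
    then have "Im (- inverse u) < 0" using nz im by (simp add: divide_less_0_iff)
    then have "- pi < Im (Ln (- inverse u))" "Im (Ln (- inverse u)) < 0"
      using nz mpi_less_Im_Ln[of "- inverse u"] Im_Ln_pos_le[of "- inverse u"] Im_Ln_le_pi[of "- inverse u"] by auto
    moreover have "0 < Im (Ln (1 - u))" "Im (Ln (1 - u)) < pi"
      using less nz Im_Ln_pos_lt[of "1 - u"] by auto
    ultimately show ?thesis by linarith
  next
    case equal
    then have "u = of_real (Re u)" "Re u < 0"
      using assms by (auto simp: complex_nonneg_Reals_iff complex_eq_iff)
    then obtain r where r: "u = of_real r" "r < 0" by blast
    have "- inverse u = of_real (- inverse r)" "1 - u = of_real (1 - r)" by (auto simp: r)
    moreover have "- inverse r > 0" "1 - r > 0" using r by auto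
    ultimately have "Im (Ln (- inverse u)) = 0" "Im (Ln (1 - u)) = 0"
      by (simp_all only: Ln_of_real Im_complex_of_real)
    then show ?thesis by simp
  qed
  then have "Ln (- inverse u * (1 - u)) = Ln (- inverse u) + Ln (1 - u)"
    using nz by (intro Ln_times_simple) auto
  moreover have "- inverse u * (1 - u) = 1 - inverse u"
    using nz by (simp add: field_simps)
  ultimately have "Ln (1 - inverse u) = Ln (- inverse u) + Ln (1 - u)" by simp
  then have "(- inverse u) powr \<nu> * (1 - inverse u) powr (1 - \<nu>)
      = exp (\<nu> * Ln (- inverse u)) * exp ((1 - \<nu>) * (Ln (- inverse u) + Ln (1 - u)))"
    using nz by (simp add: powr_def)
  also have "\<dots> = exp (Ln (- inverse u) + (1 - \<nu>) * Ln (1 - u))"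
    unfolding exp_add[symmetric] by (rule arg_cong[of _ _ exp]) algebra
  also have "\<dots> = - inverse u * (1 - u) powr (1 - \<nu>)"
    using nz by (simp add: exp_add powr_def)
  also have "\<dots> = - ((1 - u) powr (1 - \<nu>) / u)"
    by (simp add: divide_inverse mult.commute)
  finally show ?thesis .
qed

context parameters
begin

text \<open>
  The integrand of the loop integral in the variable \<open>u = 1 / t\<close>, including the factor from
  \<open>dt = - du / u^2\<close>; the sign is absorbed by the change of orientation.
\<close>

definition reciprocal_integrand :: "(complex \<Rightarrow> complex) \<Rightarrow> complex \<Rightarrow> complex \<Rightarrow> complex" where
  "reciprocal_integrand K z u =
     exp (- x * z / u) * K (- ((1 - u) powr (1 - \<nu>) / u) * z) / (1 - u)"

lemma inv_integrand_reciprocal: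
  assumes "u = 1 \<or> u \<notin> \<real>\<^sub>\<ge>\<^sub>0"
  shows "inv_integrand x \<nu> K z (inverse u) = u\<^sup>2 * reciprocal_integrand K z u"
proof (cases "u = 1")
  case False
  then have u: "u \<notin> \<real>\<^sub>\<ge>\<^sub>0" using assms by simp
  then have nz: "u \<noteq> 0" by auto
  have "inverse u * (inverse u - 1) = (1 - u) / u\<^sup>2"
    using nz by (simp add: field_simps power2_eq_square)
  moreover have "z * (- inverse u) powr \<nu> * (1 - inverse u) powr (1 - \<nu>)
      = - ((1 - u) powr (1 - \<nu>) / u) * z"
    using powr_reciprocal[OF u, of \<nu>] by (simp add: mult_ac)
  ultimately show ?thesis
    by (simp add: inv_integrand_def reciprocal_integrand_def divide_inverse mult_ac)
qed (simp add: inv_integrand_def reciprocal_integrand_def)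

text \<open>
  Writing \<open>K w = w * k w\<close> cancels the pole at \<open>u = 1\<close>: the remaining power
  \<open>(1 - u) powr (- \<nu>)\<close> tends to \<open>0\<close> there because \<open>Re \<nu> < 0\<close>. At \<open>u = 1\<close> itself both sides are \<open>0\<close>.
\<close>

lemma reciprocal_integrand_factored:
  assumes "\<And>w. K w = w * k w"
  shows "reciprocal_integrand K z u = exp (- x * z / u) * k (- ((1 - u) powr (1 - \<nu>) / u) * z)
    * (- z / u) * (1 - u) powr (- \<nu>)"
proof (cases "u = 1")
  case False
  then have "(1 - u) powr (- \<nu>) = (1 - u) powr (1 - \<nu>) / (1 - u)"
    using powr_diff[of "1 - u" "1 - \<nu>" 1] by simp
  then show ?thesis
    by (simp add: reciprocal_integrand_def assms)
qed (simp add: reciprocal_integrand_def)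

lemma continuous_on_reciprocal_integrand:
  assumes "K \<in> H0"
  shows "continuous_on {u. u \<noteq> 0 \<and> (u = 1 \<or> 1 - u \<notin> \<real>\<^sub>\<le>\<^sub>0)} (reciprocal_integrand K z)"
proof -
  obtain k where k: "k holomorphic_on UNIV" "\<And>w. K w = w * k w"
    using H0_factor[OF assms] by blast
  have pw: "continuous_on {u. u \<noteq> 0 \<and> (u = 1 \<or> 1 - u \<notin> \<real>\<^sub>\<le>\<^sub>0)} (\<lambda>u. (1 - u) powr e)"
    if "Re e > 0" for e
    using that
    by (intro continuous_on_powr_complex continuous_intros)
       (auto simp: complex_nonpos_Reals_iff)
  have quotient: "continuous_on {u. u \<noteq> 0 \<and> (u = 1 \<or> 1 - u \<notin> \<real>\<^sub>\<le>\<^sub>0)} (\<lambda>u. g u / u)"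
    if "continuous_on {u. u \<noteq> 0 \<and> (u = 1 \<or> 1 - u \<notin> \<real>\<^sub>\<le>\<^sub>0)} g" for g :: "complex \<Rightarrow> complex"
    using that by (intro continuous_on_divide continuous_on_id) auto
  show ?thesis
    unfolding reciprocal_integrand_factored[OF k(2)] using Re_nu
    by (intro continuous_on_mult continuous_on_exp continuous_on_minus continuous_on_const quotient
          continuous_entire_compose[OF k(1)] pw) auto
qed

lemma holomorphic_on_reciprocal_integrand:
  assumes "K \<in> H0"
  shows "reciprocal_integrand K z holomorphic_on (ball 0 1 - {0})"
proof -
  have K: "K holomorphic_on UNIV" using assms by (simp add: H0_def)
  show ?thesis
    unfolding reciprocal_integrand_def using disc_avoids_cut
    by (intro holomorphic_intros holomorphic_on_compose_gen[OF _ K, unfolded o_def]) force+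
qed

lemma holomorphic_on_inv_integrand:
  assumes "K \<in> H0"
  shows "inv_integrand x \<nu> K z holomorphic_on - \<real>\<^sub>\<ge>\<^sub>0"
proof -
  have K: "K holomorphic_on UNIV" using assms by (simp add: H0_def)
  have cut: "- t \<notin> \<real>\<^sub>\<le>\<^sub>0" "1 - t \<notin> \<real>\<^sub>\<le>\<^sub>0" "t \<noteq> 0" "t - 1 \<noteq> 0" if "t \<in> - \<real>\<^sub>\<ge>\<^sub>0" for t :: complex
    using that by (auto simp: complex_nonneg_Reals_iff complex_nonpos_Reals_iff)
  show ?thesis
    unfolding inv_integrand_def
    by (intro holomorphic_intros holomorphic_on_compose_gen[OF _ K, unfolded o_def])
       (use cut in auto)
qed

lemma continuous_on_inv_integrand:
  assumes "K \<in> H0"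
  shows "continuous_on (insert 1 (- \<real>\<^sub>\<ge>\<^sub>0)) (inv_integrand x \<nu> K z)"
proof -
  let ?S = "{u. u \<noteq> 0 \<and> (u = 1 \<or> 1 - u \<notin> \<real>\<^sub>\<le>\<^sub>0)}"
  have inv: "inverse t = 1 \<or> inverse t \<notin> \<real>\<^sub>\<ge>\<^sub>0" "inverse t \<in> ?S" "t \<noteq> 0"
    if "t \<in> insert 1 (- \<real>\<^sub>\<ge>\<^sub>0)" for t :: complex
  proof -
    show *: "inverse t = 1 \<or> inverse t \<notin> \<real>\<^sub>\<ge>\<^sub>0" "t \<noteq> 0"
      using that nonneg_Reals_inverse_I[of "inverse t"] by auto
    then show "inverse t \<in> ?S"
      by (auto simp: complex_nonneg_Reals_iff complex_nonpos_Reals_iff)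
  qed
  have inverse: "continuous_on (insert 1 (- \<real>\<^sub>\<ge>\<^sub>0)) (inverse :: complex \<Rightarrow> complex)"
    using inv(3) by (intro continuous_on_inverse continuous_on_id) blast
  then have "continuous_on (insert 1 (- \<real>\<^sub>\<ge>\<^sub>0))
      (\<lambda>t. (inverse t)\<^sup>2 * reciprocal_integrand K z (inverse t))"
    using inv(2)
    by (intro continuous_on_mult continuous_on_power
          continuous_on_compose2[OF continuous_on_reciprocal_integrand[OF assms]] image_subsetI)
  then show ?thesis
  proof (rule continuous_on_eq)
    show "(inverse t)\<^sup>2 * reciprocal_integrand K z (inverse t) = inv_integrand x \<nu> K z t"
      if "t \<in> insert 1 (- \<real>\<^sub>\<ge>\<^sub>0)" for t
      using inv_integrand_reciprocal[of "inverse t" K z] inv[OF that] by simp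
  qed
qed

lemma contour_integral_unit_circle_reciprocal:
  "contour_integral (circlepath 0 1) (inv_integrand x \<nu> K z)
     = contour_integral (circlepath 0 1) (reciprocal_integrand K z)"
proof -
  define e where "e = (\<lambda>s::real. exp (2 * of_real pi * \<i> * of_real s))"
  have circ: "circlepath 0 1 = e" by (simp add: circlepath e_def fun_eq_iff)
  have norm_e: "norm (e s) = 1" for s by (simp add: e_def)
  have rev: "reversepath (circlepath 0 1) s = inverse (e s)" for s
    by (simp add: reversepath_def circ e_def exp_minus[symmetric] algebra_simps exp_diff)
       (simp add: exp_minus field_simps)
  have "((\<lambda>s. inverse (e s)) has_vector_derivative - (2 * of_real pi * \<i>) * inverse (e s)) (at s)" for s
  proof -
    have "((\<lambda>w. exp (- (2 * of_real pi * \<i> * w))) has_field_derivative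
        - (2 * of_real pi * \<i>) * exp (- (2 * of_real pi * \<i> * of_real s))) (at (of_real s))"
      by (auto intro!: derivative_eq_intros)
    from has_vector_derivative_real_field[OF this] show ?thesis
      by (simp add: e_def exp_minus)
  qed
  then have vd: "vector_derivative (reversepath (circlepath 0 1)) (at s)
      = - (2 * of_real pi * \<i>) * inverse (e s)" for s
    unfolding rev[abs_def] by (rule vector_derivative_at)
  have "contour_integral (circlepath 0 1) (inv_integrand x \<nu> K z)
      = - contour_integral (reversepath (circlepath 0 1)) (inv_integrand x \<nu> K z)"
    by (simp add: contour_integral_reversepath)
  also have "\<dots> = integral {0..1}
      (\<lambda>s. inv_integrand x \<nu> K z (inverse (e s)) * (2 * of_real pi * \<i> * inverse (e s)))"
    unfolding contour_integral_integral vd rev by (simp flip: integral_neg)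
  also have "\<dots> = integral {0..1} (\<lambda>s. reciprocal_integrand K z (e s) * (2 * of_real pi * \<i> * e s))"
  proof (rule integral_cong)
    fix s
    have "e s = 1 \<or> e s \<notin> \<real>\<^sub>\<ge>\<^sub>0"
      using norm_e[of s] by (auto elim!: nonneg_Reals_cases)
    moreover have "e s \<noteq> 0" by (simp add: e_def)
    ultimately show "inv_integrand x \<nu> K z (inverse (e s)) * (2 * of_real pi * \<i> * inverse (e s))
      = reciprocal_integrand K z (e s) * (2 * of_real pi * \<i> * e s)"
      by (simp only: inv_integrand_reciprocal) (simp add: power2_eq_square)
  qed
  also have "\<dots> = contour_integral (circlepath 0 1) (reciprocal_integrand K z)"
    unfolding contour_integral_integral vector_derivative_circlepath by (simp add: circ e_def)
  finally show ?thesis .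
qed

text \<open>
  Between concentric circles inside the open unit disc the integral does not change, by Cauchy's
  theorem. The unit circle passes through the branch point \<open>u = 1\<close>, but the integrand is continuous
  up to it, so the integral over the circle of radius \<open>r\<close> is continuous for \<open>r \<le> 1\<close>.
\<close>

lemma contour_integral_reciprocal_shrink:
  assumes "K \<in> H0"
  shows "contour_integral (circlepath 0 1) (reciprocal_integrand K z)
     = contour_integral (circlepath 0 radius) (reciprocal_integrand K z)"
proof -
  define e where "e = (\<lambda>s::real. exp (2 * of_real pi * \<i> * of_real s))"
  have circ: "circlepath 0 r s = of_real r * e s" for r s by (simp add: circlepath e_def)
  have norm_e: "norm (e s) = 1" for s by (simp add: e_def)
  define \<Phi> where "\<Phi> = (\<lambda>r. contour_integral (circlepath 0 r) (reciprocal_integrand K z))"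
  have \<Phi>: "\<Phi> = (\<lambda>r. integral (cbox 0 1) (\<lambda>s. reciprocal_integrand K z (of_real r * e s)
      * (2 * of_real pi * \<i> * of_real r * e s)))"
    unfolding \<Phi>_def contour_integral_integral vector_derivative_circlepath circ
    by (simp add: e_def)
  have in_domain: "of_real r * e s \<in> {u. u \<noteq> 0 \<and> (u = 1 \<or> 1 - u \<notin> \<real>\<^sub>\<le>\<^sub>0)}" if "r \<in> {radius..1}" for r s
  proof -
    define u where "u = of_real r * e s"
    have "norm u = r" using that radius by (simp add: u_def norm_mult norm_e)
    moreover have "u = 1" if "1 - u \<in> \<real>\<^sub>\<le>\<^sub>0" "norm u \<le> 1"
      using that abs_Re_le_cmod[of u]
      by (auto simp: complex_nonpos_Reals_iff complex_eq_iff)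
    ultimately show ?thesis using that radius unfolding u_def[symmetric] by auto
  qed
  have ce: "continuous_on S (\<lambda>p. e (f p))" if "continuous_on S f"
    for S :: "(real \<times> real) set" and f
    unfolding e_def by (intro continuous_intros that)
  have "continuous_on ({radius..1} \<times> cbox 0 1)
      (\<lambda>p. reciprocal_integrand K z (of_real (fst p) * e (snd p)))"
  proof (rule continuous_on_compose2[OF continuous_on_reciprocal_integrand[OF assms]])
    show "continuous_on ({radius..1} \<times> cbox 0 1) (\<lambda>p. of_real (fst p) * e (snd p))"
      by (intro continuous_on_mult continuous_on_of_real continuous_on_fst
          continuous_on_snd continuous_on_id ce)
  qed (use in_domain in force)
  moreover have "continuous_on ({radius..1} \<times> cbox 0 1)
      (\<lambda>p. 2 * of_real pi * \<i> * of_real (fst p) * e (snd p))"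
    by (intro continuous_on_mult continuous_on_const continuous_on_of_real continuous_on_fst
          continuous_on_snd continuous_on_id ce)
  ultimately have "continuous_on ({radius..1} \<times> cbox 0 1)
      (\<lambda>(r, s). reciprocal_integrand K z (of_real r * e s) * (2 * of_real pi * \<i> * of_real r * e s))"
    unfolding case_prod_beta by (rule continuous_on_mult)
  then have \<Phi>_cont: "continuous_on {radius..1} \<Phi>"
    unfolding \<Phi> by (rule integral_continuous_on_param)
  have \<Phi>_const: "\<Phi> r = \<Phi> radius" if "r \<in> {radius..<1}" for r
    unfolding \<Phi>_def
    by (rule contour_integral_circlepath_eq(3)[of "ball 0 1"])
       (use that radius holomorphic_on_reciprocal_integrand[OF assms] in auto)
  have clo: "closure {radius..<1} = {radius..1}"
    using radius by simp
  have "\<Phi> 1 = \<Phi> radius"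
    by (rule continuous_constant_on_closure[of "{radius..<1}" \<Phi>, OF _ \<Phi>_const])
       (use \<Phi>_cont radius in \<open>simp_all only: clo, simp\<close>)
  then show ?thesis by (simp add: \<Phi>_def)
qed

lemma M_op_eq_reciprocal:
  "M_op K z = (1 - x) / (2 * \<i> * of_real pi * x) * exp z
     * contour_integral (circlepath 0 radius) (reciprocal_integrand K z)"
proof -
  have "contour_integral (circlepath 0 radius)
      (\<lambda>u. exp ((u - x) / u * z) * K (- ((1 - u) powr (1 - \<nu>) / u) * z) / (1 - u))
    = contour_integral (circlepath 0 radius) (\<lambda>u. exp z * reciprocal_integrand K z u)"
  proof (rule contour_integral_cong[OF refl])
    fix u :: complex assume "u \<in> path_image (circlepath 0 radius)"
    then have "u \<noteq> 0" using radius by auto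
    then have "(u - x) / u * z = z + (- x * z / u)" by (simp add: field_simps)
    then have "exp ((u - x) / u * z) = exp z * exp (- x * z / u)" by (simp only: exp_add)
    then show "exp ((u - x) / u * z) * K (- ((1 - u) powr (1 - \<nu>) / u) * z) / (1 - u)
        = exp z * reciprocal_integrand K z u"
      by (simp add: reciprocal_integrand_def)
  qed
  also have "\<dots> = exp z * contour_integral (circlepath 0 radius) (reciprocal_integrand K z)"
    unfolding contour_integral_integral mult.assoc by (rule integral_mult_right)
  finally show ?thesis
    by (simp add: M_op_def mult_ac)
qed

lemma has_contour_integral_inv_integrand:
  assumes "K \<in> H0" "loop_from_1_around_0 \<gamma>"
  shows "inv_integrand x \<nu> K z contour_integrable_on \<gamma>"
    and "M_op K z = (1 - x) / (2 * \<i> * of_real pi * x) * exp z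
           * contour_integral \<gamma> (inv_integrand x \<nu> K z)"
proof -
  obtain I where I: "\<And>\<gamma>. loop_from_1_around_0 \<gamma> \<Longrightarrow> (inv_integrand x \<nu> K z has_contour_integral I) \<gamma>"
    using contour_integral_loop_from_1_indep[OF holomorphic_on_inv_integrand[OF assms(1)]
        continuous_on_inv_integrand[OF assms(1)]] by blast
  show "inv_integrand x \<nu> K z contour_integrable_on \<gamma>"
    using I[OF assms(2)] by (auto simp: contour_integrable_on_def)
  have "contour_integral \<gamma> (inv_integrand x \<nu> K z)
      = contour_integral (circlepath 0 1) (inv_integrand x \<nu> K z)"
    using I[OF assms(2)] I[OF loop_from_1_around_0_circlepath] contour_integral_unique by metis
  then show "M_op K z = (1 - x) / (2 * \<i> * of_real pi * x) * exp z
           * contour_integral \<gamma> (inv_integrand x \<nu> K z)"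
    by (simp add: M_op_eq_reciprocal contour_integral_unit_circle_reciprocal
          contour_integral_reciprocal_shrink[OF assms(1)])
qed

end

section \<open>The inversion theorem\<close>

theorem theorem4p1:
  fixes x \<nu> :: complex
  assumes "x \<notin> \<real>\<^sub>\<le>\<^sub>0" and "x \<noteq> 1" and "Re \<nu> < 0"
  shows "bij_betw (Lop x \<nu>) H0 H0 \<and>
    (\<forall>K\<in>H0. \<forall>\<gamma>. loop_from_1_around_0 \<gamma> \<longrightarrow>
      (\<forall>z. inv_integrand x \<nu> K z contour_integrable_on \<gamma> \<and>
           inv_into H0 (Lop x \<nu>) K z =
             (1 - x) / (2 * \<i> * of_real pi * x) * exp z * contour_integral \<gamma> (inv_integrand x \<nu> K z)))"
proof -
  interpret parameters x \<nu>
    using assms by unfold_locales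
  show ?thesis
    using Lop_bij_betw has_contour_integral_inv_integrand inv_into_Lop by simp
qed

end
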